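(* Let $(a;b)\in U^{o}$ with $a$ even and $b$ odd. If $Q(a;b)\in\mathbb Z$, then $a^2\equiv-1\pmod b$. In particular, $$Q(a;b)=0\iff a^2\equiv -1\pmod b.$$
   Context: Let $\mathfrak H$ be the upper half plane. For $\tau\in\mathfrak H$ let $q=e^{2\pi\sqrt{-1}\tau}$ and, with fractional powers $q^{r}=e^{2\pi\sqrt{-1}r\tau}$, let $\theta_1(z,\tau)=2\sum_{n\ge 0}(-1)^n q^{\frac12(n+\frac12)^2}\sin((2n+1)\pi z)$, $\theta_2(z,\tau)=2\sum_{n\ge 0} q^{\frac12(n+\frac12)^2}\cos((2n+1)\pi z)$, $\theta_3(z,\tau)=1+2\sum_{n\ge1}q^{\frac12 n^2}\cos(2n\pi z)$, $\theta_4(z,\tau)=1+2\sum_{n\ge1}(-1)^nq^{\frac12 n^2}\cos(2n\pi z)$. Put $k=\theta_2(0,\tau)^2/\theta_3(0,\tau)^2$, $\lambda(\tau)=k^2$, $K=\frac{\pi}{2}\theta_3(0,\tau)^2$. The Jacobi elliptic function $\mathrm{cs}=\mathrm{cn}/\mathrm{sn}$ satisfies $$\mathrm{cs}(2Kz,k)=\frac{\theta_4(0,\tau)}{\theta_3(0,\tau)}\,\frac{\theta_2(z,\tau)}{\theta_1(z,\tau)}.$$ Let $U^{o}=\{(a;b)\in(\mathbb Z\setminus\{0\})\times\mathbb Z_{>0} : \gcd(a,b)=1,\ a+b\text{ odd}\}$. The elliptic classical Dedekind sum is $$s_\tau(a;b)=\frac{1}{4b}\sum_{\substack{0\le\mu,\nu\le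 b-1\\(\mu,\nu)\ne(0,0)}}(-1)^{\mu}\,\mathrm{cs}\!\left(2Ka\tfrac{\mu\tau+\nu}{b},k\right)\mathrm{cs}\!\left(2K\tfrac{\mu\tau+\nu}{b},k\right),\qquad s_\tau(a;1)=0 .$$ For $(a;b)\in U^{o}$, $Q(a;b)$ denotes the unique rational number, independent of $\tau$ (its existence is a known fact), such that $s_\tau(a;b)=Q(a;b)\left(\frac13-\frac16\lambda(\tau)\right)$. *)

theory Defs
  imports Complex_Main "HOL-Number_Theory.Cong"
begin

definition upper_half_plane :: "complex set" where
  "upper_half_plane = {\<tau>. Im \<tau> > 0}"

text \<open>
  Fractional powers of the nome are taken through \<open>\<tau>\<close>, i.e.\ \<open>q\<^sup>r = exp (2 \<pi> \<i> r \<tau>)\<close>;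
  they are not principal powers of the complex number \<open>q\<close>.
\<close>

definition qpow :: "complex \<Rightarrow> real \<Rightarrow> complex" where
  "qpow \<tau> r = exp (2 * of_real pi * \<i> * of_real r * \<tau>)"

definition theta1 :: "complex \<Rightarrow> complex \<Rightarrow> complex" where
  "theta1 z \<tau> = 2 * (\<Sum>n::nat. (-1) ^ n * qpow \<tau> ((real n + 1/2)\<^sup>2 / 2)
                          * sin (of_nat (2 * n + 1) * of_real pi * z))"

definition theta2 :: "complex \<Rightarrow> complex \<Rightarrow> complex" where
  "theta2 z \<tau> = 2 * (\<Sum>n::nat. qpow \<tau> ((real n + 1/2)\<^sup>2 / 2)
                          * cos (of_nat (2 * n + 1) * of_real pi * z))"

text \<open>The sums over \<open>n \<ge> 1\<close> are shifted to start at \<open>0\<close>.\<close>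

definition theta3 :: "complex \<Rightarrow> complex \<Rightarrow> complex" where
  "theta3 z \<tau> = 1 + 2 * (\<Sum>n::nat. qpow \<tau> ((real (Suc n))\<^sup>2 / 2)
                          * cos (of_nat (2 * Suc n) * of_real pi * z))"

definition theta4 :: "complex \<Rightarrow> complex \<Rightarrow> complex" where
  "theta4 z \<tau> = 1 + 2 * (\<Sum>n::nat. (-1) ^ Suc n * qpow \<tau> ((real (Suc n))\<^sup>2 / 2)
                          * cos (of_nat (2 * Suc n) * of_real pi * z))"

definition ell_modulus :: "complex \<Rightarrow> complex" where
  "ell_modulus \<tau> = (theta2 0 \<tau>)\<^sup>2 / (theta3 0 \<tau>)\<^sup>2"

definition mod_lambda :: "complex \<Rightarrow> complex" where
  "mod_lambda \<tau> = (ell_modulus \<tau>)\<^sup>2"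

definition ell_K :: "complex \<Rightarrow> complex" where
  "ell_K \<tau> = of_real (pi / 2) * (theta3 0 \<tau>)\<^sup>2"

text \<open>
  \<open>jacobi_cs \<tau> u\<close> is \<open>cs(u, k)\<close> for the modulus \<open>k = ell_modulus \<tau>\<close>. It is given by the classical
  theta quotient with \<open>z = u / (2 K)\<close>, so \<open>jacobi_cs \<tau> (2 * ell_K \<tau> * z)\<close> is
  \<open>(\<theta>\<^sub>4(0) / \<theta>\<^sub>3(0)) (\<theta>\<^sub>2(z) / \<theta>\<^sub>1(z))\<close>. The parameter is \<open>\<tau>\<close> rather than \<open>k\<close>, which \<open>\<tau>\<close> determines.
\<close>

definition jacobi_cs :: "complex \<Rightarrow> complex \<Rightarrow> complex" where
  "jacobi_cs \<tau> u = theta4 0 \<tau> / theta3 0 \<tau>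
       * (theta2 (u / (2 * ell_K \<tau>)) \<tau> / theta1 (u / (2 * ell_K \<tau>)) \<tau>)"

definition Uo :: "(int \<times> int) set" where
  "Uo = {(a, b). a \<noteq> 0 \<and> b > 0 \<and> gcd a b = 1 \<and> odd (a + b)}"

text \<open>
  For \<open>(a, b) \<in> Uo\<close> no summand has a pole. For \<open>b = 1\<close> the sum is empty, so the value is \<open>0\<close>.
\<close>

definition ell_dedekind_sum :: "complex \<Rightarrow> int \<Rightarrow> int \<Rightarrow> complex" where
  "ell_dedekind_sum \<tau> a b = 1 / (4 * of_int b) *
     (\<Sum>(\<mu>, \<nu>) \<in> ({0..b - 1} \<times> {0..b - 1}) - {(0, 0)}.
        (-1) ^ nat \<mu>
        * jacobi_cs \<tau> (2 * ell_K \<tau> * of_int a * ((of_int \<mu> * \<tau> + of_int \<nu>) / of_int b))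
        * jacobi_cs \<tau> (2 * ell_K \<tau> * ((of_int \<mu> * \<tau> + of_int \<nu>) / of_int b)))"

text \<open>One rational number has to serve all \<open>\<tau>\<close>. The description is meaningful for \<open>(a, b) \<in> Uo\<close>.\<close>

definition Q :: "int \<Rightarrow> int \<Rightarrow> rat" where
  "Q a b = (THE r::rat. \<forall>\<tau>\<in>upper_half_plane.
       ell_dedekind_sum \<tau> a b = of_rat r * (1/3 - 1/6 * mod_lambda \<tau>))"

end

theory Submission
  imports Defs "HOL-Complex_Analysis.Complex_Analysis"
begin

text \<open>
  The sum of the residues of the elliptic function \<open>cs(2Kz) cs(2Kaz) cs(2Kbz)\<close> vanishes. Since
  \<open>cs u = 1/u - (1/3 - \<lambda>/6) u + \<dots>\<close>, this is the reciprocity law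
  \<open>4 a b (s(a;b) + s(b;a)) = (a\<^sup>2 + b\<^sup>2 + 1) (1/3 - \<lambda>/6)\<close>. Moreover \<open>s(a;b)\<close> is odd in \<open>a\<close>
  and depends only on \<open>a\<close> modulo \<open>2b\<close>, so a Euclidean descent shows that \<open>N = 4 b Q(a;b)\<close> exists, is
  an integer and satisfies \<open>a N \<equiv> a\<^sup>2 + 1\<close> modulo \<open>b\<close>. If \<open>Q(a;b)\<close> is an integer, \<open>b\<close> divides \<open>N\<close>
  and hence \<open>a\<^sup>2 + 1\<close>. Conversely, if \<open>b\<close> divides \<open>a\<^sup>2 + 1\<close>, multiplication by \<open>a\<close> permutes the
  \<open>b\<close>-division points and changes the sign of every summand, so \<open>s(a;b) = 0\<close>.

  By Liouville's theorem a doubly periodic function with removable singularities is constant. Applied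
  to the quotient of theta1 and Euler's product this yields the zeros of theta1; applied to
  differences of squares of the quotients cs, ds, ns and to \<open>cs' + ds ns\<close> it yields the coefficient
  \<open>1/3 - \<lambda>/6\<close>; applied to a combination of logarithmic derivatives of theta1 it shows that residues
  sum to zero.
\<close>

section \<open>Simple poles and doubly periodic functions\<close>

text \<open>The product of the three cs functions has a triple pole at the origin, whereas the
  residue argument is set up for simple poles only. For this reason \<open>1 / (a b)\<close> times
  the product of cs, ds and ns, each scaled to residue 1, is subtracted: it has the same triple pole
  and both periods, and its residue is 0 because \<open>cs' = - ds ns\<close> makes it a derivative.
  The origin then contributes exactly the term with \<open>1/3 - \<lambda>/6\<close>.

  Parity enters through the sign change of cs(2Kz) under \<tau>. The triple product picks up the
  sign with exponent 1 + a + b, so it has period \<tau> precisely when a + b is odd, and its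
  residues at the division points carry the alternating sign of the Dedekind sum.\<close>

lemma analytic_at_shift:
  fixes f :: "complex \<Rightarrow> complex"
  assumes "f analytic_on {c + w}"
  shows "(\<lambda>z. f (z + w)) analytic_on {c}"
proof -
  have "(f \<circ> (\<lambda>z. z + w)) analytic_on {c}"
    by (rule analytic_on_compose) (use assms in \<open>auto intro!: analytic_intros\<close>)
  thus ?thesis by (simp add: o_def)
qed

lemma analytic_at_scale:
  fixes f :: "complex \<Rightarrow> complex"
  assumes "f analytic_on {w * c}"
  shows "(\<lambda>z. f (w * z)) analytic_on {c}"
proof -
  have "(f \<circ> (\<lambda>z. w * z)) analytic_on {c}"
    by (rule analytic_on_compose) (use assms in \<open>auto intro!: analytic_intros\<close>)
  thus ?thesis by (simp add: o_def)
qed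

lemma analytic_difference_quotient:
  fixes g :: "complex \<Rightarrow> complex"
  assumes "g analytic_on {c}"
  obtains k where "k analytic_on {c}" "k c = deriv g c" "\<And>z. g z = g c + (z - c) * k z"
proof
  let ?k = "\<lambda>z. if z = c then deriv g c else g z / (z - c) - g c / (z - c)"
  show "?k analytic_on {c}"
    by (rule pole_theorem_analytic[OF assms]) (auto intro!: exI[of _ 1])
  show "?k c = deriv g c" by simp
  show "g z = g c + (z - c) * ?k z" for z by (auto simp: divide_simps)
qed

text \<open>The pole is at most simple: \<open>r = 0\<close> means a removable singularity. The
  equation is demanded only near \<open>c\<close>, not at \<open>c\<close>, so the value that
  division by zero assigns to a quotient at its pole is harmless.\<close>

definition simple_pole_part :: "(complex \<Rightarrow> complex) \<Rightarrow> complex \<Rightarrow> complex \<Rightarrow> bool" where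
  "simple_pole_part f c r \<longleftrightarrow>
     (\<exists>h. h analytic_on {c} \<and> (\<forall>\<^sub>F z in at c. f z = r / (z - c) + h z))"

lemma simple_pole_partI:
  "h analytic_on {c} \<Longrightarrow> (\<forall>\<^sub>F z in at c. f z = r / (z - c) + h z) \<Longrightarrow> simple_pole_part f c r"
  by (auto simp: simple_pole_part_def)

lemma simple_pole_part_analytic: "f analytic_on {c} \<Longrightarrow> simple_pole_part f c 0"
  by (rule simple_pole_partI[of f]) auto

lemma simple_pole_part_cong:
  assumes "simple_pole_part f c r" "\<forall>\<^sub>F z in at c. g z = f z"
  shows "simple_pole_part g c r"
proof -
  obtain h where h: "h analytic_on {c}" "\<forall>\<^sub>F z in at c. f z = r / (z - c) + h z"
    using assms(1) by (auto simp: simple_pole_part_def)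
  from h(2) assms(2) have "\<forall>\<^sub>F z in at c. g z = r / (z - c) + h z"
    by eventually_elim simp
  with h(1) show ?thesis by (rule simple_pole_partI)
qed

lemma simple_pole_part_add:
  assumes "simple_pole_part f c r" "simple_pole_part g c s"
  shows "simple_pole_part (\<lambda>z. f z + g z) c (r + s)"
proof -
  obtain h where h: "h analytic_on {c}" "\<forall>\<^sub>F z in at c. f z = r / (z - c) + h z"
    using assms(1) by (auto simp: simple_pole_part_def)
  obtain k where k: "k analytic_on {c}" "\<forall>\<^sub>F z in at c. g z = s / (z - c) + k z"
    using assms(2) by (auto simp: simple_pole_part_def)
  have "\<forall>\<^sub>F z in at c. f z + g z = (r + s) / (z - c) + (h z + k z)"
    using h(2) k(2) by eventually_elim (simp add: add_divide_distrib)
  with h(1) k(1) show ?thesis by (intro simple_pole_partI[of "\<lambda>z. h z + k z"] analytic_intros)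
qed

lemma simple_pole_part_mult_analytic:
  assumes "simple_pole_part f c r" "g analytic_on {c}"
  shows "simple_pole_part (\<lambda>z. f z * g z) c (r * g c)"
proof -
  obtain h where h: "h analytic_on {c}" "\<forall>\<^sub>F z in at c. f z = r / (z - c) + h z"
    using assms(1) by (auto simp: simple_pole_part_def)
  obtain k where k: "k analytic_on {c}" "\<And>z. g z = g c + (z - c) * k z"
    using analytic_difference_quotient[OF assms(2)] by metis
  have "\<forall>\<^sub>F z in at c. z \<noteq> c" by (simp add: eventually_at_filter)
  with h(2) have "\<forall>\<^sub>F z in at c. f z * g z = (r * g c) / (z - c) + (r * k z + h z * g z)"
  proof eventually_elim
    case (elim z)
    have "r / (z - c) * g z = r / (z - c) * (g c + (z - c) * k z)" using k(2)[of z] by simp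
    also have "\<dots> = (r * g c) / (z - c) + r * k z" using elim(2) by (simp add: field_simps)
    finally show ?case using elim(1) by (simp add: algebra_simps)
  qed
  with h(1) k(1) assms(2) show ?thesis
    by (intro simple_pole_partI[of "\<lambda>z. r * k z + h z * g z"] analytic_intros)
qed

lemma simple_pole_part_cmult:
  "simple_pole_part f c r \<Longrightarrow> simple_pole_part (\<lambda>z. s * f z) c (s * r)"
  using simple_pole_part_mult_analytic[of f c r "\<lambda>_. s"] by (simp add: mult.commute)

lemma simple_pole_part_diff:
  "simple_pole_part f c r \<Longrightarrow> simple_pole_part g c s \<Longrightarrow> simple_pole_part (\<lambda>z. f z - g z) c (r - s)"
  using simple_pole_part_add[of f c r "\<lambda>z. -1 * g z" "-1 * s"] simple_pole_part_cmult[of g c s "-1"]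
  by simp

lemma simple_pole_part_sum:
  assumes "\<And>i. i \<in> I \<Longrightarrow> simple_pole_part (f i) c (r i)"
  shows "simple_pole_part (\<lambda>z. \<Sum>i\<in>I. f i z) c (\<Sum>i\<in>I. r i)"
  using assms
proof (induction I rule: infinite_finite_induct)
  case (insert i I)
  then show ?case using simple_pole_part_add[of "f i" c "r i"] by simp
qed (auto intro: simple_pole_part_analytic)

lemma simple_pole_part_shift:
  assumes "simple_pole_part f (c + w) r"
  shows "simple_pole_part (\<lambda>z. f (z + w)) c r"
proof -
  obtain h where h: "h analytic_on {c + w}" "\<forall>\<^sub>F z in at (c + w). f z = r / (z - (c + w)) + h z"
    using assms(1) by (auto simp: simple_pole_part_def)
  from h(2) have "\<forall>\<^sub>F z in at (c + w - w). f (z + w) = r / (z + w - (c + w)) + h (z + w)"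
    unfolding filtermap_at_shift[symmetric] eventually_filtermap by simp
  hence "\<forall>\<^sub>F z in at c. f (z + w) = r / (z - c) + h (z + w)" by simp
  with analytic_at_shift[OF h(1)] show ?thesis by (rule simple_pole_partI)
qed

text \<open>Dividing out the zero gives \<open>d z = (z - c) * k z\<close> with
  \<open>k c = deriv d c\<close>. If \<open>n\<close> vanishes at \<open>c\<close> as well, the
  residue is 0; in this form the lemma removes the singularity of theta1 over Euler's
  product.\<close>

lemma simple_pole_part_divide:
  assumes "n analytic_on {c}" "d analytic_on {c}" "d c = 0" "deriv d c \<noteq> 0"
  shows "simple_pole_part (\<lambda>z. n z / d z) c (n c / deriv d c)"
proof -
  obtain k where k: "k analytic_on {c}" "k c = deriv d c" "\<And>z. d z = d c + (z - c) * k z"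
    using analytic_difference_quotient[OF assms(2)] by metis
  have "simple_pole_part (\<lambda>z. 1 / (z - c)) c 1"
    by (rule simple_pole_partI[of "\<lambda>_. 0"]) auto
  moreover have "(\<lambda>z. n z / k z) analytic_on {c}"
    by (intro analytic_intros assms k) (use k assms in auto)
  ultimately have "simple_pole_part (\<lambda>z. 1 / (z - c) * (n z / k z)) c (1 * (n c / k c))"
    by (rule simple_pole_part_mult_analytic)
  moreover have "1 / (z - c) * (n z / k z) = n z / d z" for z
    using k(3)[of z] assms(3) by simp
  ultimately show ?thesis using k(2) by (simp only: mult_1)
qed

text \<open>Where the discs of the local analytic parts overlap, both parts are the limit of
  \<open>g\<close>, so their values at the centres glue to one entire function. Limits are used
  because \<open>g\<close> may take wrong values at isolated points.\<close>

lemma removable_extension: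
  assumes "\<And>c. simple_pole_part g c 0"
  obtains G where "G holomorphic_on UNIV" "\<And>c. (g \<longlongrightarrow> G c) (at c)"
proof -
  have loc: "\<exists>h e. h holomorphic_on ball c e \<and> e > 0 \<and> (\<forall>z\<in>ball c e - {c}. g z = h z)" for c
  proof -
    obtain h where h: "h analytic_on {c}" "\<forall>\<^sub>F z in at c. g z = h z"
      using assms[of c] by (auto simp: simple_pole_part_def)
    obtain e1 where e1: "e1 > 0" "h holomorphic_on ball c e1" using h(1) by (auto simp: analytic_on_def)
    obtain e2 where e2: "e2 > 0" "\<forall>z. z \<noteq> c \<and> dist z c < e2 \<longrightarrow> g z = h z"
      using h(2) unfolding eventually_at by auto
    have "h holomorphic_on ball c (min e1 e2)" by (rule holomorphic_on_subset[OF e1(2)]) auto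
    moreover have "\<forall>z\<in>ball c (min e1 e2) - {c}. g z = h z" using e2 by (auto simp: dist_commute)
    ultimately show ?thesis using e1 e2 by (metis min_less_iff_conj)
  qed
  obtain h e where he: "\<And>c. h c holomorphic_on ball c (e c)" "\<And>c::complex. e c > (0::real)"
      "\<And>c z. z \<in> ball c (e c) - {c} \<Longrightarrow> g z = h c z"
    using loc by metis
  have lim: "(g \<longlongrightarrow> h c z) (at z)" if z: "z \<in> ball c (e c)" for c z
  proof -
    have "isCont (h c) z" using he(1)[of c] z
      by (metis holomorphic_on_imp_continuous_on continuous_on_eq_continuous_at open_ball)
    hence "(h c \<longlongrightarrow> h c z) (at z)" by (simp add: isCont_def)
    moreover have "\<forall>\<^sub>F w in at z. h c w = g w"
    proof (cases "z = c")
      case True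
      have "\<forall>\<^sub>F w in at c. w \<in> ball c (e c) - {c}"
        using he(2)[of c] by (auto simp: eventually_at dist_commute)
      thus ?thesis unfolding True by eventually_elim (simp add: he(3))
    next
      case False
      have "\<forall>\<^sub>F w in nhds z. w \<in> ball c (e c) - {c}"
        by (rule eventually_nhds_in_open) (use z False in auto)
      hence "\<forall>\<^sub>F w in at z. w \<in> ball c (e c) - {c}" by (auto simp: eventually_at_filter elim: eventually_mono)
      thus ?thesis by eventually_elim (simp add: he(3))
    qed
    ultimately show ?thesis by (rule Lim_transform_eventually)
  qed
  have "(\<lambda>c. h c c) holomorphic_on ball c (e c)" for c
  proof (rule holomorphic_transform[OF he(1)])
    fix z assume z: "z \<in> ball c (e c)"
    show "h c z = h z z"
      by (rule tendsto_unique[OF _ lim[OF z] lim]) (auto simp: he)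
  qed
  hence "(\<lambda>c. h c c) analytic_on UNIV" unfolding analytic_on_def using he(2) by blast
  hence "(\<lambda>c. h c c) holomorphic_on UNIV" by (rule analytic_imp_holomorphic)
  moreover have "(g \<longlongrightarrow> h c c) (at c)" for c by (rule lim) (simp add: he)
  ultimately show thesis by (rule that)
qed

section \<open>Doubly periodic functions and Liouville's theorem\<close>

lemma periodic_int_multiple:
  fixes f :: "complex \<Rightarrow> 'a"
  assumes "\<And>z. f (z + w) = f z"
  shows "f (z + of_int m * w) = f z"
proof -
  have nat: "f (z + of_nat n * w) = f z" for z n
  proof (induction n)
    case (Suc n)
    have "f (z + of_nat (Suc n) * w) = f ((z + of_nat n * w) + w)" by (simp add: algebra_simps)
    with Suc assms show ?case by simp
  qed simp
  show ?thesis
  proof (cases "m \<ge> 0")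
    case True
    then show ?thesis using nat[of z "nat m"] by simp
  next
    case False
    then show ?thesis using nat[of "z + of_int m * w" "nat (-m)"] by simp
  qed
qed

lemma elliptic_entire_constant:
  assumes tau: "Im \<tau> > 0" and G: "G holomorphic_on UNIV"
    and per: "\<And>z. G (z + 1) = G z" "\<And>z. G (z + \<tau>) = G z"
  obtains C where "\<And>z. G z = C"
proof -
  define S where "S = (\<lambda>(x, y). complex_of_real x + of_real y * \<tau>) ` ({0..1} \<times> {0..1})"
  have "compact S" unfolding S_def
    by (intro compact_continuous_image compact_Times compact_Icc) (auto intro!: continuous_intros simp: split_def)
  moreover have "continuous_on S G"
    using G holomorphic_on_imp_continuous_on continuous_on_subset by blast
  ultimately have "bounded (G ` S)" by (intro compact_imp_bounded compact_continuous_image)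
  moreover have "range G \<subseteq> G ` S"
  proof clarify
    fix z
    define y where "y = Im z / Im \<tau>"
    define x where "x = Re z - y * Re \<tau>"
    have z: "z = of_real x + of_real y * \<tau>"
      using tau by (auto simp: complex_eq_iff x_def y_def)
    define z' where "z' = z + of_int (-\<lfloor>x\<rfloor>) * 1 + of_int (-\<lfloor>y\<rfloor>) * \<tau>"
    have "G z' = G z" unfolding z'_def
      using periodic_int_multiple[of G, OF per(1)] periodic_int_multiple[of G, OF per(2)] by metis
    moreover have "z' = of_real (frac x) + of_real (frac y) * \<tau>"
      unfolding z'_def z by (simp add: frac_def algebra_simps)
    hence "z' \<in> S" unfolding S_def
      by (intro image_eqI[where x = "(frac x, frac y)"]) (auto intro: less_imp_le[OF frac_lt_1])
    ultimately show "G z \<in> G ` S" by (metis imageI)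
  qed
  ultimately have "G constant_on UNIV" using Liouville_theorem[OF G] bounded_subset by blast
  thus thesis using that by (auto simp: constant_on_def)
qed

text \<open>The value form serves points of continuity; the limit form serves points where
  singularities cancel and the value of \<open>g\<close> itself may be a mere default.\<close>

lemma elliptic_removable_constant:
  assumes tau: "Im \<tau> > 0" and g: "\<And>c. simple_pole_part g c 0"
    and per: "\<And>z. g (z + 1) = g z" "\<And>z. g (z + \<tau>) = g z"
  obtains C where "\<And>c. isCont g c \<Longrightarrow> g c = C" "\<And>c. (g \<longlongrightarrow> C) (at c)"
proof -
  obtain G where G: "G holomorphic_on UNIV" "\<And>c. (g \<longlongrightarrow> G c) (at c)"
    using removable_extension[OF g] by blast
  have perG: "G (c + w) = G c" if "\<And>z. g (z + w) = g z" for w c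
  proof -
    have "((\<lambda>z. g (z + w)) \<longlongrightarrow> G (c + w)) (at (c + w - w))" by (rule LIM_offset[OF G(2)])
    hence "(g \<longlongrightarrow> G (c + w)) (at c)" using that by simp
    thus ?thesis using G(2) by (intro tendsto_unique[of "at c"]) auto
  qed
  obtain C where C: "\<And>z. G z = C"
    by (rule elliptic_entire_constant[OF tau G(1)]) (use perG per in auto)
  show thesis
  proof
    show "(g \<longlongrightarrow> C) (at c)" for c using G(2)[of c] C by simp
    show "g c = C" if "isCont g c" for c
      using that G(2)[of c] C by (metis isCont_def tendsto_unique trivial_limit_at)
  qed
qed

text \<open>The increment \<open>K\<close> disappears on differentiation, so the derivative of the
  entire extension is doubly periodic, hence constant. The extension is affine; period 1 kills its
  slope and with it \<open>K\<close>. This replaces integration around a period parallelogram. The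
  increment is required only near each point, since logarithmic derivatives obey their shift law
  only off the poles.\<close>

lemma quasi_period_zero:
  assumes tau: "Im \<tau> > 0" and g: "\<And>c. simple_pole_part g c 0"
    and per: "\<And>z. g (z + 1) = g z"
    and qper: "\<And>c. \<forall>\<^sub>F z in at c. g (z + \<tau>) = g z + K"
  shows "K = 0"
proof -
  obtain G where G: "G holomorphic_on UNIV" "\<And>c. (g \<longlongrightarrow> G c) (at c)"
    using removable_extension[OF g] by blast
  have perG: "G (c + w) = G c + K" if "\<And>c. \<forall>\<^sub>F z in at c. g (z + w) = g z + K" for w c K
  proof -
    have "((\<lambda>z. g (z + w)) \<longlongrightarrow> G (c + w)) (at (c + w - w))" by (rule LIM_offset[OF G(2)])
    hence "((\<lambda>z. g (z + w)) \<longlongrightarrow> G (c + w)) (at c)" by simp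
    moreover have "((\<lambda>z. g (z + w)) \<longlongrightarrow> G c + K) (at c)"
    proof (rule Lim_transform_eventually)
      show "((\<lambda>z. g z + K) \<longlongrightarrow> G c + K) (at c)" by (intro tendsto_intros G)
      show "\<forall>\<^sub>F z in at c. g z + K = g (z + w)" using that[of c] by eventually_elim simp
    qed
    ultimately show ?thesis by (intro tendsto_unique[of "at c"]) auto
  qed
  have 1: "G (c + 1) = G c" for c using perG[of 1 0 c] per by simp
  have 2: "G (c + \<tau>) = G c + K" for c using perG[OF qper] .
  have dG: "(G has_field_derivative deriv G z) (at z)" for z
    using G(1) holomorphic_derivI by blast
  have dper: "deriv G (z + w) = deriv G z" if "\<And>c. G (c + w) = G c + L" for z w L
  proof -
    have "((\<lambda>z. G (z + w)) has_field_derivative deriv G (z + w)) (at z)"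
      using dG[of "z + w"] DERIV_shift by blast
    moreover have "((\<lambda>z. G (z + w)) has_field_derivative deriv G z) (at z)"
      unfolding that by (auto intro!: derivative_eq_intros dG)
    ultimately show ?thesis by (rule DERIV_unique)
  qed
  obtain D where D: "\<And>z. deriv G z = D"
    by (rule elliptic_entire_constant[OF tau, of "deriv G"])
       (use 1 2 dper[of 1 0] dper[of \<tau> K] G(1) in \<open>auto intro: holomorphic_deriv\<close>)
  have "\<exists>d. \<forall>z. G z - D * z = d"
  proof -
    have "((\<lambda>z. G z - D * z) has_field_derivative 0) (at z)" for z
      using dG[of z] by (auto intro!: derivative_eq_intros simp: D)
    hence "\<exists>d. \<forall>z\<in>UNIV. G z - D * z = d"
      by (intro has_field_derivative_zero_constant) auto
    thus ?thesis by auto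
  qed
  then obtain d where d: "\<And>z. G z = D * z + d" by (metis add.commute diff_add_cancel)
  have "D = 0" using 1[of 0] by (simp add: d)
  thus "K = 0" using 2[of 0] by (simp add: d)
qed

section \<open>Theta functions\<close>

lemma summable_power_series_ratio_tendsto_0:
  fixes a :: "nat \<Rightarrow> complex"
  assumes "\<And>n. a (Suc n) = a n * \<rho> n" "\<rho> \<longlonglongrightarrow> 0"
  shows "summable (\<lambda>n. a n * x ^ n)"
proof -
  have "(\<lambda>n. norm (\<rho> n * x)) \<longlonglongrightarrow> norm (0 * x)" by (intro tendsto_intros assms)
  hence "\<forall>\<^sub>F n in sequentially. norm (\<rho> n * x) < 1/2" by (rule order_tendstoD) simp
  then obtain N where N: "\<And>n. n \<ge> N \<Longrightarrow> norm (\<rho> n * x) < 1/2"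
    by (auto simp: eventually_sequentially)
  show ?thesis
  proof (rule summable_ratio_test)
    show "norm (a (Suc n) * x ^ Suc n) \<le> 1/2 * norm (a n * x ^ n)" if "n \<ge> N" for n
    proof -
      have "norm (a (Suc n) * x ^ Suc n) = norm (\<rho> n * x) * norm (a n * x ^ n)"
        by (simp add: assms norm_mult norm_power)
      also have "\<dots> \<le> 1/2 * norm (a n * x ^ n)" using N[OF that] by (intro mult_right_mono) auto
      finally show ?thesis .
    qed
  qed simp
qed

lemma holomorphic_power_series_UNIV:
  fixes a :: "nat \<Rightarrow> complex"
  assumes "\<And>x. summable (\<lambda>n. a n * x ^ n)"
  shows "(\<lambda>x. \<Sum>n. a n * x ^ n) holomorphic_on UNIV"
proof -
  have "(\<lambda>x. \<Sum>n. a n * x ^ n) holomorphic_on ball 0 r" for r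
    by (rule power_series_holomorphic[where a = a]) (use assms in \<open>auto intro: summable_sums\<close>)
  hence "(\<lambda>x. \<Sum>n. a n * x ^ n) analytic_on UNIV"
    unfolding analytic_on_def
    by (metis (no_types, lifting) UNIV_I analytic_on_def analytic_on_open dist_norm diff_zero
        dist_commute gt_ex mem_ball open_ball norm_minus_commute)
  thus ?thesis by (rule analytic_imp_holomorphic)
qed

text \<open>Half of a bilateral theta series. Unlike the whole series it is entire in
  \<open>y\<close>; its values at \<open>y\<close> and \<open>1 / y\<close> together recover the
  whole.\<close>

definition theta_half :: "complex \<Rightarrow> complex \<Rightarrow> complex" where
  "theta_half p y = (\<Sum>n. p ^ (n\<^sup>2) * y ^ n)"

lemma summable_theta_half:
  fixes p y :: complex
  assumes "norm p < 1"
  shows "summable (\<lambda>n. p ^ (n\<^sup>2) * y ^ n)"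
proof (rule summable_power_series_ratio_tendsto_0[where \<rho> = "\<lambda>n. p * (p ^ n * p ^ n)"])
  show "p ^ (Suc n)\<^sup>2 = p ^ (n\<^sup>2) * (p * (p ^ n * p ^ n))" for n
    by (simp add: power2_eq_square power_add power_mult algebra_simps)
  have "(\<lambda>n. p * (p ^ n * p ^ n)) \<longlonglongrightarrow> p * (0 * 0)"
    by (intro tendsto_intros LIMSEQ_power_zero assms)
  thus "(\<lambda>n. p * (p ^ n * p ^ n)) \<longlonglongrightarrow> 0" by simp
qed

lemma holomorphic_theta_half: "norm p < 1 \<Longrightarrow> theta_half p holomorphic_on UNIV"
  unfolding theta_half_def[abs_def]
  by (intro holomorphic_power_series_UNIV summable_theta_half)

lemma theta_half_0 [simp]: "theta_half p 0 = 1"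
  using powser_zero[of "\<lambda>n. p ^ (n\<^sup>2)"] by (simp add: theta_half_def)

lemma theta_half_rec:
  assumes "norm p < 1"
  shows "theta_half p y = 1 + p * y * theta_half p (p\<^sup>2 * y)"
proof -
  have "(\<Sum>n. p ^ (Suc n)\<^sup>2 * y ^ Suc n) = theta_half p y - p ^ (0\<^sup>2) * y ^ 0"
    unfolding theta_half_def by (rule suminf_split_head[OF summable_theta_half[OF assms]])
  moreover have "p ^ (Suc n)\<^sup>2 * y ^ Suc n = p * y * (p ^ (n\<^sup>2) * (p\<^sup>2 * y) ^ n)" for n
    by (simp add: power2_eq_square power_add power_mult power_mult_distrib algebra_simps)
  hence "(\<Sum>n. p ^ (Suc n)\<^sup>2 * y ^ Suc n) = p * y * theta_half p (p\<^sup>2 * y)"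
    unfolding theta_half_def by (simp only:) (intro suminf_mult summable_theta_half assms)
  ultimately have "theta_half p y - p ^ 0\<^sup>2 * y ^ 0 = p * y * theta_half p (p\<^sup>2 * y)" by (simp only:)
  thus ?thesis by (simp add: algebra_simps)
qed

text \<open>Otherwise \<open>theta_half p x = 1 - theta_half p (1 / x)\<close> tends to 0 at
  infinity, and Liouville's theorem makes the entire function vanish, against its value 1 at 0. This
  excludes that the bilateral theta series is identically 0.\<close>

lemma theta_half_not_antisymmetric:
  assumes "norm p < 1"
  shows "\<exists>x. x \<noteq> 0 \<and> theta_half p x + theta_half p (1 / x) \<noteq> 1"
proof (rule ccontr)
  assume "\<not> ?thesis"
  hence eq: "theta_half p x = 1 - theta_half p (inverse x)" if "x \<noteq> 0" for x
    using that by (metis eq_diff_eq inverse_eq_divide)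
  have "isCont (theta_half p) 0"
    using holomorphic_theta_half[OF assms] holomorphic_on_imp_continuous_on
    by (metis UNIV_I continuous_on_eq_continuous_at open_UNIV)
  hence "((\<lambda>x. theta_half p (inverse x)) \<longlongrightarrow> theta_half p 0) at_infinity"
    by (rule isCont_tendsto_compose[OF _ tendsto_inverse_0])
  hence "((\<lambda>x. 1 - theta_half p (inverse x)) \<longlongrightarrow> 1 - theta_half p 0) at_infinity"
    by (intro tendsto_intros)
  moreover have "\<forall>\<^sub>F x in at_infinity. 1 - theta_half p (inverse x) = theta_half p x"
    unfolding eventually_at_infinity by (auto intro!: exI[of _ 1] eq[symmetric])
  ultimately have "(theta_half p \<longlongrightarrow> 1 - theta_half p 0) at_infinity"
    by (rule Lim_transform_eventually)
  hence "(theta_half p \<longlongrightarrow> 0) at_infinity" by simp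
  from Liouville_weak[OF holomorphic_theta_half[OF assms] this, of 0] show False by simp
qed

text \<open>Euler's expansion of the infinite product \<open>(1 - y) (1 - q y) (1 - q\<^sup>2 y) \<cdots>\<close>.\<close>

definition euler_series :: "complex \<Rightarrow> complex \<Rightarrow> complex" where
  "euler_series q y = (\<Sum>n. (\<Prod>k<n. - (q ^ k) / (1 - q ^ Suc k)) * y ^ n)"

lemma summable_euler_series:
  fixes q y :: complex
  assumes "norm q < 1"
  shows "summable (\<lambda>n. (\<Prod>k<n. - (q ^ k) / (1 - q ^ Suc k)) * y ^ n)"
proof (rule summable_power_series_ratio_tendsto_0[where \<rho> = "\<lambda>n. - (q ^ n) / (1 - q ^ Suc n)"])
  have "(\<lambda>n. - (q ^ n) / (1 - q ^ Suc n)) \<longlonglongrightarrow> - 0 / (1 - 0)"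
    by (intro tendsto_intros LIMSEQ_power_zero assms filterlim_compose[OF LIMSEQ_power_zero[OF assms] filterlim_Suc]) auto
  thus "(\<lambda>n. - (q ^ n) / (1 - q ^ Suc n)) \<longlonglongrightarrow> 0" by simp
qed simp

lemma holomorphic_euler_series: "norm q < 1 \<Longrightarrow> euler_series q holomorphic_on UNIV"
  unfolding euler_series_def[abs_def]
  by (intro holomorphic_power_series_UNIV summable_euler_series)

lemma euler_series_0 [simp]: "euler_series q 0 = 1"
  using powser_zero[of "\<lambda>n. \<Prod>k<n. - (q ^ k) / (1 - q ^ Suc k)"] by (simp add: euler_series_def)

text \<open>Read coefficientwise, the functional equation is the recursion
  \<open>a (Suc n) * (1 - q ^ Suc n) = - a n * q ^ n\<close>, which defines the
  coefficients.\<close>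

lemma euler_series_rec:
  assumes "norm q < 1"
  shows "euler_series q y = (1 - y) * euler_series q (q * y)"
proof -
  define a where "a = (\<lambda>n. \<Prod>k<n. - (q ^ k) / (1 - q ^ Suc k))"
  have "q ^ Suc n \<noteq> 1" for n
  proof
    assume "q ^ Suc n = 1"
    hence "norm q ^ Suc n = 1" by (metis norm_power norm_one)
    thus False using assms by (metis less_irrefl nat.distinct(1) norm_ge_zero power_eq_1_iff real_norm_def abs_norm_cancel)
  qed
  hence a: "a (Suc n) - a (Suc n) * q ^ Suc n = - a n * q ^ n" for n
  proof -
    have "a (Suc n) = a n * (- (q ^ n) / (1 - q ^ Suc n))" by (simp add: a_def)
    moreover have "1 - q ^ Suc n \<noteq> 0" using \<open>q ^ Suc n \<noteq> 1\<close> by simp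
    ultimately have "a (Suc n) * (1 - q ^ Suc n) = - a n * q ^ n" by simp
    thus ?thesis by (simp only: right_diff_distrib mult_1_right)
  qed
  have s1: "(\<lambda>n. a n * y ^ n) sums euler_series q y"
    unfolding a_def euler_series_def by (intro summable_sums summable_euler_series assms)
  have s2: "(\<lambda>n. a n * (q * y) ^ n) sums euler_series q (q * y)"
    unfolding a_def euler_series_def by (intro summable_sums summable_euler_series assms)
  have "(\<lambda>n. a n * y ^ n - a n * (q * y) ^ n) sums (euler_series q y - euler_series q (q * y))"
    by (intro sums_diff s1 s2)
  hence "(\<lambda>n. a (Suc n) * y ^ Suc n - a (Suc n) * (q * y) ^ Suc n) sums (euler_series q y - euler_series q (q * y))"
    by (subst sums_Suc_iff) simp
  moreover have "a (Suc n) * y ^ Suc n - a (Suc n) * (q * y) ^ Suc n = - y * (a n * (q * y) ^ n)" for n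
  proof -
    have "a (Suc n) * y ^ Suc n - a (Suc n) * (q * y) ^ Suc n
        = (a (Suc n) - a (Suc n) * q ^ Suc n) * y ^ Suc n"
      by (simp add: power_mult_distrib algebra_simps)
    thus ?thesis unfolding a by (simp add: power_mult_distrib algebra_simps)
  qed
  moreover have "(\<lambda>n. - y * (a n * (q * y) ^ n)) sums (- y * euler_series q (q * y))"
    by (intro sums_mult s2)
  ultimately have "euler_series q y - euler_series q (q * y) = - y * euler_series q (q * y)"
    by (simp only:) (rule sums_unique2)
  thus ?thesis by (simp add: algebra_simps)
qed

text \<open>If no factor \<open>1 - q ^ k * y\<close> vanishes, the functional equation pushes the
  zero from \<open>y\<close> along \<open>q ^ n * y\<close> towards 0, where the series has the
  value 1.\<close>

lemma euler_series_eq_0: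
  assumes "norm q < 1" "euler_series q y = 0"
  shows "\<exists>k. q ^ k * y = 1"
proof (rule ccontr)
  assume *: "\<not> ?thesis"
  have "euler_series q (q ^ n * y) = 0" for n
  proof (induction n)
    case (Suc n)
    with euler_series_rec[OF assms(1), of "q ^ n * y"] * show ?case by (auto simp: mult.assoc)
  qed (use assms in simp)
  moreover have "(\<lambda>n. euler_series q (q ^ n * y)) \<longlonglongrightarrow> euler_series q (0 * y)"
  proof (rule isCont_tendsto_compose[where g = "euler_series q"])
    show "isCont (euler_series q) (0 * y)"
      using holomorphic_euler_series[OF assms(1)] holomorphic_on_imp_continuous_on
      by (metis UNIV_I continuous_on_eq_continuous_at open_UNIV)
  qed (intro tendsto_intros LIMSEQ_power_zero assms)
  ultimately show False using LIMSEQ_unique[of "\<lambda>_. 0::complex" 0 1] by simp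
qed

definition lattice :: "complex \<Rightarrow> complex set" where
  "lattice \<tau> = {of_int m * \<tau> + of_int n | m n. True}"

section \<open>The four theta functions as translates of one bilateral series\<close>

locale upper_half_point =
  fixes \<tau> :: complex
  assumes Im_pos: "Im \<tau> > 0"
begin

text \<open>\<open>p\<close> is the nome, with \<open>qpow \<tau> 1\<close> equal to
  \<open>p\<^sup>2\<close>; thus the exponents \<open>n\<^sup>2 / 2\<close> of the theta series
  become integral. \<open>Y\<close> and \<open>r\<close> are roots chosen through \<open>z\<close>
  and \<open>\<tau>\<close>, with \<open>X = Y\<^sup>2\<close> and \<open>p = r ^ 4\<close>.\<close>

definition p :: complex where "p = exp (\<i> * of_real pi * \<tau>)"
definition X :: "complex \<Rightarrow> complex" where "X z = exp (2 * \<i> * of_real pi * z)"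
definition Y :: "complex \<Rightarrow> complex" where "Y z = exp (\<i> * of_real pi * z)"
definition r :: complex where "r = exp (\<i> * of_real pi * \<tau> / 4)"
text \<open>The sum of \<open>p ^ (n\<^sup>2) * X z ^ n\<close> over all integers \<open>n\<close>.
  The term for \<open>n = 0\<close> occurs in both halves, hence the subtracted 1.\<close>

definition J :: "complex \<Rightarrow> complex" where "J z = theta_half p (X z) + theta_half p (1 / X z) - 1"

lemma norm_p: "norm p < 1"
  using Im_pos by (simp add: p_def)

lemma norm_p2: "norm (p\<^sup>2) < 1"
  using norm_p by (simp add: norm_power power_less_one_iff)

lemma XY_nonzero [simp]: "p \<noteq> 0" "X z \<noteq> 0" "Y z \<noteq> 0" "r \<noteq> 0"
  by (auto simp: p_def X_def Y_def r_def)

lemma XY_simps: "X z = Y z * Y z" "Y 0 = 1" "X 0 = 1" "Y (z + w) = Y z * Y w" "Y \<tau> = p" "Y (-z) = 1 / Y z"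
  by (simp_all add: X_def Y_def p_def exp_add[symmetric] algebra_simps exp_minus divide_inverse)

lemma Y_1: "Y 1 = -1"
  by (simp add: Y_def)

lemma Y_half: "Y (1/2) = \<i>"
proof -
  have "Y (1/2) = cis (pi / 2)" unfolding cis_conv_exp Y_def by simp
  thus ?thesis by simp
qed

lemma Y_half_tau: "Y (\<tau> / 2) = r * r"
  by (simp add: Y_def r_def exp_add[symmetric] mult_ac)

lemma p_r: "p = r ^ 4"
  unfolding r_def p_def exp_of_nat_mult[symmetric] by simp

lemma X_shift: "X (z + 1) = X z" "X (z + \<tau>) = p\<^sup>2 * X z" "X (z + \<tau> / 2) = p * X z" "X (z + 1 / 2) = - X z"
    "X (-z) = 1 / X z"
  by (simp_all add: XY_simps Y_1 Y_half Y_half_tau p_r power2_eq_square power4_eq_xxxx algebra_simps del: mult_minus_left)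
     (simp add: mult.assoc[symmetric])?

text \<open>Adding \<tau> shifts the summation index by one. In terms of the two halves,
  \<open>theta_half_rec\<close> takes the constant term out of one half and puts one into the other,
  and a common factor remains.\<close>

lemma J_shift: "J (z + 1) = J z" "J (- z) = J z" "J (z + \<tau>) = J z / (p * X z)"
proof -
  show "J (z + 1) = J z" "J (- z) = J z" by (simp_all add: J_def X_shift)
  have 1: "theta_half p (X z) = 1 + p * X z * theta_half p (p\<^sup>2 * X z)"
    by (rule theta_half_rec[OF norm_p])
  have "theta_half p (1 / (p\<^sup>2 * X z)) = 1 + p * (1 / (p\<^sup>2 * X z)) * theta_half p (p\<^sup>2 * (1 / (p\<^sup>2 * X z)))"
    by (rule theta_half_rec[OF norm_p])
  hence 2: "theta_half p (1 / (p\<^sup>2 * X z)) = 1 + theta_half p (1 / X z) / (p * X z)"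
    by (simp add: power2_eq_square)
  show "J (z + \<tau>) = J z / (p * X z)"
    unfolding J_def X_shift 1 2 by (simp add: field_simps)
qed

lemma J_holomorphic: "J holomorphic_on UNIV"
proof -
  have h: "(\<lambda>z. theta_half p (f z)) holomorphic_on UNIV" if "f holomorphic_on UNIV" for f
    using holomorphic_on_compose[OF that, of "theta_half p"] holomorphic_theta_half[OF norm_p]
    by (auto simp: o_def intro: holomorphic_on_subset)
  show ?thesis unfolding J_def[abs_def]
    by (intro holomorphic_intros h) (auto simp: X_def intro!: holomorphic_intros)
qed

lemma qpow_p: "qpow \<tau> (x / 2) = exp (of_real x * (\<i> * of_real pi * \<tau>))"
  by (simp add: qpow_def algebra_simps)

lemma qpow_square: "qpow \<tau> ((real n)\<^sup>2 / 2) = p ^ (n\<^sup>2)"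
  unfolding qpow_p p_def by (simp add: exp_of_nat_mult[symmetric])

text \<open>From \<open>(n + 1/2)\<^sup>2 = n\<^sup>2 + n + 1/4\<close>: the constant yields
  \<open>r\<close>, and the linear part \<open>p ^ n\<close> can be absorbed into the argument as a
  shift of \<open>z\<close> by \<open>\<tau> / 2\<close>.\<close>

lemma qpow_half: "qpow \<tau> ((real n + 1/2)\<^sup>2 / 2) = r * (p ^ (n\<^sup>2) * p ^ n)"
proof -
  have "r * (p ^ (n\<^sup>2) * p ^ n) = exp (\<i> * of_real pi * \<tau> / 4 + (of_nat (n\<^sup>2) * (\<i> * of_real pi * \<tau>) + of_nat n * (\<i> * of_real pi * \<tau>)))"
    unfolding p_def r_def by (simp only: exp_add exp_of_nat_mult)
  also have "\<i> * of_real pi * \<tau> / 4 + (of_nat (n\<^sup>2) * (\<i> * of_real pi * \<tau>) + of_nat n * (\<i> * of_real pi * \<tau>))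
     = of_real ((real n + 1/2)\<^sup>2) * (\<i> * of_real pi * \<tau>)"
    unfolding of_real_power of_real_add of_nat_power of_real_of_nat_eq power2_sum distrib_right
    by (simp add: power2_eq_square)
  finally show ?thesis unfolding qpow_p ..
qed

lemma X_power: "X z ^ n = exp (of_nat n * (2 * \<i> * of_real pi * z))"
    "(1 / X z) ^ n = exp (- (of_nat n * (2 * \<i> * of_real pi * z)))"
  by (simp_all only: X_def exp_of_nat_mult exp_minus power_one_over inverse_eq_divide)

lemma cos_even: "2 * cos (of_nat (2 * n) * of_real pi * z) = X z ^ n + (1 / X z) ^ n"
proof -
  have "\<i> * (of_nat (2 * n) * of_real pi * z) = of_nat n * (2 * \<i> * of_real pi * z)" by simp
  thus ?thesis by (simp only: cos_exp_eq X_power) simp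
qed

lemma exp_odd: "exp (\<i> * (of_nat (2 * n + 1) * of_real pi * z)) = Y z * X z ^ n"
   "exp (- (\<i> * (of_nat (2 * n + 1) * of_real pi * z))) = 1 / Y z * (1 / X z) ^ n"
proof -
  have *: "\<i> * (of_nat (2 * n + 1) * of_real pi * z) = \<i> * of_real pi * z + of_nat n * (2 * \<i> * of_real pi * z)"
    by (simp add: algebra_simps)
  show 1: "exp (\<i> * (of_nat (2 * n + 1) * of_real pi * z)) = Y z * X z ^ n"
    unfolding * X_power Y_def by (rule exp_add)
  show "exp (- (\<i> * (of_nat (2 * n + 1) * of_real pi * z))) = 1 / Y z * (1 / X z) ^ n"
    unfolding exp_minus 1 by (simp add: divide_inverse power_inverse)
qed

lemma cos_odd: "2 * cos (of_nat (2 * n + 1) * of_real pi * z) = Y z * X z ^ n + 1 / Y z * (1 / X z) ^ n"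
  unfolding cos_exp_eq by (simp only: exp_odd) simp

lemma sin_odd: "2 * sin (of_nat (2 * n + 1) * of_real pi * z) = - \<i> * (Y z * X z ^ n - 1 / Y z * (1 / X z) ^ n)"
  unfolding sin_exp_eq by (simp only: exp_odd) (simp add: field_simps)

lemma theta_half_sums_shift:
  "(\<lambda>n. p ^ (Suc n)\<^sup>2 * (y ^ Suc n + (1 / y) ^ Suc n) / 2) sums ((theta_half p y + theta_half p (1 / y) - 2) / 2)"
proof -
  have s: "(\<lambda>n. p ^ (Suc n)\<^sup>2 * y ^ Suc n) sums (theta_half p y - 1)" for y
    using summable_sums[OF summable_theta_half[OF norm_p, of y]] unfolding theta_half_def[symmetric]
    by (subst sums_Suc_iff) simp
  have "(\<lambda>n. (p ^ (Suc n)\<^sup>2 * y ^ Suc n + p ^ (Suc n)\<^sup>2 * (1 / y) ^ Suc n) / 2)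
       sums ((theta_half p y - 1 + (theta_half p (1 / y) - 1)) / 2)"
    by (intro sums_divide sums_add s)
  thus ?thesis by (simp add: algebra_simps)
qed

lemma theta3_J: "theta3 z \<tau> = J z"
proof -
  have "p ^ (Suc n)\<^sup>2 * (X z ^ Suc n + (1 / X z) ^ Suc n) / 2
     = qpow \<tau> ((real (Suc n))\<^sup>2 / 2) * cos (of_nat (2 * Suc n) * of_real pi * z)" for n
    unfolding cos_even[symmetric] qpow_square by simp
  with theta_half_sums_shift[of "X z"]
  have "(\<lambda>n. qpow \<tau> ((real (Suc n))\<^sup>2 / 2) * cos (of_nat (2 * Suc n) * of_real pi * z))
     sums ((theta_half p (X z) + theta_half p (1 / X z) - 2) / 2)" by (simp only:)
  from sums_unique[OF this] show ?thesis unfolding theta3_def J_def by (simp add: field_simps)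
qed

lemma theta4_J: "theta4 z \<tau> = J (z + 1/2)"
proof -
  have "p ^ (Suc n)\<^sup>2 * ((- X z) ^ Suc n + (1 / - X z) ^ Suc n) / 2
     = (-1) ^ Suc n * qpow \<tau> ((real (Suc n))\<^sup>2 / 2) * cos (of_nat (2 * Suc n) * of_real pi * z)" for n
  proof -
    have "(- X z) ^ Suc n + (1 / - X z) ^ Suc n = (-1) ^ Suc n * (X z ^ Suc n + (1 / X z) ^ Suc n)"
      by (simp add: power_minus[of "X z"] power_minus[of "1 / X z"] algebra_simps power_divide)
    thus ?thesis unfolding cos_even[symmetric] qpow_square by simp
  qed
  with theta_half_sums_shift[of "- X z"]
  have "(\<lambda>n. (-1) ^ Suc n * qpow \<tau> ((real (Suc n))\<^sup>2 / 2) * cos (of_nat (2 * Suc n) * of_real pi * z))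
     sums ((theta_half p (- X z) + theta_half p (1 / - X z) - 2) / 2)" by (simp only:)
  from sums_unique[OF this] show ?thesis unfolding theta4_def J_def X_shift by (simp add: field_simps)
qed

lemma theta_half_sums: "(\<lambda>n. p ^ (n\<^sup>2) * y ^ n) sums theta_half p y"
  unfolding theta_half_def by (intro summable_sums summable_theta_half norm_p)

text \<open>This brings the half of \<open>J (z + \<tau> / 2)\<close> with negative exponents to the
  argument \<open>p / X z\<close>, where the half-integral series of theta1 and theta2 produce
  it.\<close>

lemma theta_half_inverse: "theta_half p (1 / (p * x)) = 1 + theta_half p (p / x) / x" if "x \<noteq> 0"
proof -
  have "p\<^sup>2 * (1 / (p * x)) = p / x" "p * (1 / (p * x)) = 1 / x" by (simp_all add: power2_eq_square)
  thus ?thesis using theta_half_rec[OF norm_p, of "1 / (p * x)"] by (metis mult.commute mult_1_right times_divide_eq_right)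
qed

lemma theta2_J: "theta2 z \<tau> = r * Y z * J (z + \<tau> / 2)"
proof -
  have "(\<lambda>n. r * (Y z * (p ^ (n\<^sup>2) * (p * X z) ^ n) + 1 / Y z * (p ^ (n\<^sup>2) * (p / X z) ^ n)) / 2)
     sums (r * (Y z * theta_half p (p * X z) + 1 / Y z * theta_half p (p / X z)) / 2)"
    by (intro sums_divide sums_mult sums_add theta_half_sums)
  moreover have "r * (Y z * (p ^ (n\<^sup>2) * (p * X z) ^ n) + 1 / Y z * (p ^ (n\<^sup>2) * (p / X z) ^ n)) / 2
     = qpow \<tau> ((real n + 1/2)\<^sup>2 / 2) * cos (of_nat (2 * n + 1) * of_real pi * z)" for n
  proof -
    have "qpow \<tau> ((real n + 1/2)\<^sup>2 / 2) * cos (of_nat (2 * n + 1) * of_real pi * z)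
      = qpow \<tau> ((real n + 1/2)\<^sup>2 / 2) * (2 * cos (of_nat (2 * n + 1) * of_real pi * z)) / 2" by simp
    thus ?thesis unfolding cos_odd qpow_half by (simp add: power_mult_distrib power_divide algebra_simps)
  qed
  ultimately have "(\<lambda>n. qpow \<tau> ((real n + 1/2)\<^sup>2 / 2) * cos (of_nat (2 * n + 1) * of_real pi * z))
     sums (r * (Y z * theta_half p (p * X z) + 1 / Y z * theta_half p (p / X z)) / 2)" by (simp only:)
  from sums_unique[OF this, symmetric] have "theta2 z \<tau> = r * (Y z * theta_half p (p * X z) + 1 / Y z * theta_half p (p / X z))"
    unfolding theta2_def by (simp only:) simp
  also have "\<dots> = r * Y z * J (z + \<tau> / 2)"
    unfolding J_def X_shift theta_half_inverse[OF XY_nonzero(2)] by (simp add: XY_simps(1) field_simps)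
  finally show ?thesis .
qed

text \<open>Compared with theta2, the alternating sign is a shift by 1/2, which negates
  \<open>X\<close>, and the factor \<open>- \<i>\<close> comes from the exponential form of the
  sine.\<close>

lemma theta1_J: "theta1 z \<tau> = - \<i> * r * Y z * J (z + \<tau> / 2 + 1 / 2)"
proof -
  have "(\<lambda>n. - \<i> * r * (Y z * (p ^ (n\<^sup>2) * (p * (- X z)) ^ n) - 1 / Y z * (p ^ (n\<^sup>2) * (p / (- X z)) ^ n)) / 2)
     sums (- \<i> * r * (Y z * theta_half p (p * (- X z)) - 1 / Y z * theta_half p (p / (- X z))) / 2)"
    by (intro sums_divide sums_mult sums_diff theta_half_sums)
  moreover have "- \<i> * r * (Y z * (p ^ (n\<^sup>2) * (p * (- X z)) ^ n) - 1 / Y z * (p ^ (n\<^sup>2) * (p / (- X z)) ^ n)) / 2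
     = (-1) ^ n * qpow \<tau> ((real n + 1/2)\<^sup>2 / 2) * sin (of_nat (2 * n + 1) * of_real pi * z)" for n
  proof -
    have "(-1) ^ n * qpow \<tau> ((real n + 1/2)\<^sup>2 / 2) * sin (of_nat (2 * n + 1) * of_real pi * z)
      = (-1) ^ n * qpow \<tau> ((real n + 1/2)\<^sup>2 / 2) * (2 * sin (of_nat (2 * n + 1) * of_real pi * z)) / 2" by simp
    moreover have "(p * (- X z)) ^ n = (-1) ^ n * (p ^ n * X z ^ n)" "(p / (- X z)) ^ n = (-1) ^ n * (p ^ n * (1 / X z) ^ n)"
      by (simp_all add: power_minus[of "p * X z"] power_minus[of "p / X z"] power_mult_distrib power_divide)
    ultimately show ?thesis unfolding sin_odd qpow_half by (simp add: algebra_simps)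
  qed
  ultimately have "(\<lambda>n. (-1) ^ n * qpow \<tau> ((real n + 1/2)\<^sup>2 / 2) * sin (of_nat (2 * n + 1) * of_real pi * z))
     sums (- \<i> * r * (Y z * theta_half p (p * (- X z)) - 1 / Y z * theta_half p (p / (- X z))) / 2)" by (simp only:)
  from sums_unique[OF this, symmetric] have "theta1 z \<tau> = - \<i> * r * (Y z * theta_half p (p * (- X z)) - 1 / Y z * theta_half p (p / (- X z)))"
    unfolding theta1_def by (simp only:) simp
  also have "\<dots> = - \<i> * r * Y z * J (z + \<tau> / 2 + 1 / 2)"
  proof -
    have "theta_half p (1 / - (p * X z)) = 1 + theta_half p (p / - X z) / - X z"
      using theta_half_inverse[of "- X z"] by simp
    hence J: "J (z + \<tau> / 2 + 1 / 2) = theta_half p (p * (- X z)) + theta_half p (p / - X z) / - X z"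
      unfolding J_def X_shift by simp
    have "1 / Y z = Y z / X z" by (simp add: XY_simps(1))
    thus ?thesis unfolding J by (simp add: algebra_simps)
  qed
  finally show ?thesis .
qed

end

section \<open>Zeros of the first theta function\<close>

lemma entire_analytic_at: "f holomorphic_on UNIV \<Longrightarrow> f analytic_on {c}" for f :: "complex \<Rightarrow> complex"
  by (metis analytic_on_open analytic_on_subset open_UNIV subset_UNIV)

lemma lattice_closed:
  "0 \<in> lattice \<tau>" "1 \<in> lattice \<tau>" "\<tau> \<in> lattice \<tau>"
  "w \<in> lattice \<tau> \<Longrightarrow> - w \<in> lattice \<tau>"
  "w \<in> lattice \<tau> \<Longrightarrow> w' \<in> lattice \<tau> \<Longrightarrow> w + w' \<in> lattice \<tau>"
  "w \<in> lattice \<tau> \<Longrightarrow> w' \<in> lattice \<tau> \<Longrightarrow> w - w' \<in> lattice \<tau>"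
  "of_int m * \<tau> + of_int n \<in> lattice \<tau>"
proof -
  have I: "of_int m * \<tau> + of_int n \<in> lattice \<tau>" for m n by (auto simp: lattice_def)
  show "of_int m * \<tau> + of_int n \<in> lattice \<tau>" by (rule I)
  show "0 \<in> lattice \<tau>" "1 \<in> lattice \<tau>" "\<tau> \<in> lattice \<tau>"
    using I[of 0 0] I[of 0 1] I[of 1 0] by simp_all
  assume "w \<in> lattice \<tau>"
  then obtain m n where w: "w = of_int m * \<tau> + of_int n" by (auto simp: lattice_def)
  show "- w \<in> lattice \<tau>" using I[of "-m" "-n"] by (simp add: w)
  assume "w' \<in> lattice \<tau>"
  then obtain m' n' where w': "w' = of_int m' * \<tau> + of_int n'" by (auto simp: lattice_def)
  show "w + w' \<in> lattice \<tau>" using I[of "m + m'" "n + n'"] by (simp add: w w' algebra_simps)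
  show "w - w' \<in> lattice \<tau>" using I[of "m - m'" "n - n'"] by (simp add: w w' algebra_simps)
qed

lemma periodic_lattice:
  fixes f :: "complex \<Rightarrow> 'a"
  assumes "\<And>z. f (z + 1) = f z" "\<And>z. f (z + \<tau>) = f z" "w \<in> lattice \<tau>"
  shows "f (z + w) = f z"
proof -
  obtain m n where w: "w = of_int m * \<tau> + of_int n" using assms(3) by (auto simp: lattice_def)
  have "f (z + w) = f ((z + of_int m * \<tau>) + of_int n * 1)" by (simp add: w add_ac)
  also have "\<dots> = f z" using periodic_int_multiple[of f, OF assms(1)] periodic_int_multiple[of f, OF assms(2)] by metis
  finally show ?thesis .
qed

text \<open>Since \<open>2 * \<tau>\<close> is a genuine period, \<open>m\<close> may be reduced
  modulo 2.\<close>

lemma antiperiodic_lattice: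
  fixes f :: "complex \<Rightarrow> complex"
  assumes "\<And>z. f (z + 1) = f z" "\<And>z. f (z + \<tau>) = - f z"
  shows "f (z + (of_int m * \<tau> + of_int n)) = (if even m then 1 else -1) * f z"
proof -
  have 2: "f (z + 2 * \<tau>) = f z" for z
    using assms(2)[of z] assms(2)[of "z + \<tau>"] by (simp add: add_ac)
  have "f (z + (of_int m * \<tau> + of_int n)) = f ((z + of_int m * \<tau>) + of_int n * 1)" by (simp add: add_ac)
  also have "\<dots> = f (z + of_int m * \<tau>)" by (rule periodic_int_multiple) (rule assms)
  also have "\<dots> = f (z + of_int (m mod 2) * \<tau> + of_int (m div 2) * (2 * \<tau>))"
  proof -
    have "(of_int m :: complex) = of_int (m mod 2) + of_int (m div 2) * 2"
      by (metis mod_mult_div_eq of_int_add of_int_mult of_int_numeral mult.commute)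
    thus ?thesis by (simp add: algebra_simps)
  qed
  also have "\<dots> = f (z + of_int (m mod 2) * \<tau>)" by (rule periodic_int_multiple) (rule 2)
  also have "\<dots> = (if even m then 1 else -1) * f z"
    using assms(2) by (cases "even m") (auto simp: even_iff_mod_2_eq_zero odd_iff_mod_2_eq_one)
  finally show ?thesis .
qed

lemma simple_pole_part_lattice:
  assumes "\<And>z. f (z + 1) = f z" "\<And>z. f (z + \<tau>) = f z" "w \<in> lattice \<tau>" "simple_pole_part f c s"
  shows "simple_pole_part f (c + w) s"
proof -
  have "simple_pole_part (\<lambda>z. f (z + - w)) (c + w) s"
    by (rule simple_pole_part_shift) (use assms in simp)
  moreover have "f (z + - w) = f z" for z
    by (rule periodic_lattice[OF assms(1,2) lattice_closed(4)[OF assms(3)]])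
  ultimately show ?thesis by simp
qed

lemma simple_pole_part_antiperiodic_lattice:
  assumes "\<And>z. f (z + 1) = f z" "\<And>z. f (z + \<tau>) = - f z" "w \<in> lattice \<tau>" "simple_pole_part f c 0"
  shows "simple_pole_part f (c + w) 0"
proof -
  obtain m n where w: "w = of_int m * \<tau> + of_int n" using assms(3) by (auto simp: lattice_def)
  define s :: complex where "s = (if even m then 1 else -1)"
  have "simple_pole_part (\<lambda>z. f (z + - w)) (c + w) 0"
    by (rule simple_pole_part_shift) (use assms in simp)
  hence "simple_pole_part (\<lambda>z. s * f (z + - w)) (c + w) (s * 0)"
    by (rule simple_pole_part_cmult)
  moreover have "s * f (z + - w) = f z" for z
    using antiperiodic_lattice[OF assms(1,2), of "z + - w" m n] by (simp add: w s_def)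
  ultimately show ?thesis by simp
qed

context upper_half_point
begin

lemma Im_period: "Im (2 * \<tau>) > 0" using Im_pos by simp

lemma elliptic_constant_off_lattice:
  assumes "\<And>z. f (z + 1) = f z" "\<And>z. f (z + \<tau>) = f z"
    and "simple_pole_part f 0 0" "\<And>c. c \<notin> lattice \<tau> \<Longrightarrow> f analytic_on {c}"
  obtains C where "\<And>c. c \<notin> lattice \<tau> \<Longrightarrow> f c = C" "(f \<longlongrightarrow> C) (at 0)"
proof -
  have "simple_pole_part f c 0" for c
  proof (cases "c \<in> lattice \<tau>")
    case True
    show ?thesis using simple_pole_part_lattice[OF assms(1,2) True assms(3)] by simp
  qed (use assms in \<open>auto intro: simple_pole_part_analytic\<close>)
  from elliptic_removable_constant[OF Im_pos this assms(1,2)] show thesis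
    using assms(4) analytic_at_imp_isCont that by metis
qed

lemma X_eq_1: "X z = 1 \<Longrightarrow> z \<in> lattice \<tau>"
proof -
  assume "X z = 1"
  then obtain n :: int where n: "Re (2 * \<i> * of_real pi * z) = 0" "Im (2 * \<i> * of_real pi * z) = of_int (2 * n) * pi"
    unfolding X_def exp_eq_1 by auto
  hence "z = of_int n" by (auto simp: complex_eq_iff)
  thus ?thesis using lattice_closed(7)[of 0 \<tau> n] by simp
qed

lemma X_add_tau: "X (z + of_nat k * \<tau>) = (p\<^sup>2) ^ k * X z"
proof (induction k)
  case (Suc k)
  have "X (z + of_nat (Suc k) * \<tau>) = X ((z + of_nat k * \<tau>) + \<tau>)" by (simp add: algebra_simps)
  thus ?case unfolding X_shift Suc by simp
qed simp

lemma euler_series_X_eq_0: "euler_series (p\<^sup>2) (X z) = 0 \<Longrightarrow> z \<in> lattice \<tau>"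
proof -
  assume "euler_series (p\<^sup>2) (X z) = 0"
  from euler_series_eq_0[OF norm_p2 this] obtain k where "(p\<^sup>2) ^ k * X z = 1" ..
  hence "z + of_nat k * \<tau> \<in> lattice \<tau>" by (intro X_eq_1) (simp only: X_add_tau)
  moreover have "of_nat k * \<tau> \<in> lattice \<tau>" using lattice_closed(7)[of "int k" \<tau> 0] by simp
  ultimately show ?thesis using lattice_closed(6) by fastforce
qed

lemma J_compose_holomorphic: "f holomorphic_on UNIV \<Longrightarrow> (\<lambda>z. J (f z)) holomorphic_on UNIV"
  using holomorphic_on_compose[of f UNIV J] J_holomorphic by (auto simp: o_def intro: holomorphic_on_subset)

lemma Y_holomorphic: "Y holomorphic_on UNIV"
  unfolding Y_def[abs_def] by (intro holomorphic_intros)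

lemma X_holomorphic: "X holomorphic_on UNIV"
  unfolding X_def[abs_def] by (intro holomorphic_intros)

lemma theta_holomorphic:
  "(\<lambda>z. theta1 z \<tau>) holomorphic_on UNIV" "(\<lambda>z. theta2 z \<tau>) holomorphic_on UNIV"
  "(\<lambda>z. theta3 z \<tau>) holomorphic_on UNIV" "(\<lambda>z. theta4 z \<tau>) holomorphic_on UNIV"
  unfolding theta1_J theta2_J theta3_J theta4_J
  by (intro holomorphic_intros J_compose_holomorphic Y_holomorphic)+

text \<open>\<open>J\<close> is even, but reflection turns the shift \<open>\<tau> / 2\<close> into
  \<open>- \<tau> / 2\<close>. Returning by \<tau> costs a factor \<open>X z\<close>, which
  \<open>Y (- z) = 1 / Y z\<close> compensates; for theta1 the additional shift by 1/2 turns this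
  factor into \<open>- X z\<close>.\<close>

lemma theta_minus:
  "theta1 (-z) \<tau> = - theta1 z \<tau>" "theta2 (-z) \<tau> = theta2 z \<tau>"
  "theta3 (-z) \<tau> = theta3 z \<tau>" "theta4 (-z) \<tau> = theta4 z \<tau>"
proof -
  have Jw: "J (- z + w) = J (z - w)" for w using J_shift(2)[of "z - w"] by simp
  have Jt: "J (z - \<tau> / 2 + u) = p * X (z - \<tau> / 2 + u) * J (z + \<tau> / 2 + u)" for u
  proof -
    have "(z - \<tau> / 2 + u) + \<tau> = z + \<tau> / 2 + u" by simp
    thus ?thesis using J_shift(3)[of "z - \<tau> / 2 + u"] by (simp add: field_simps)
  qed
  have Xt: "p * X (z - \<tau> / 2) = X z"
    using X_shift(3)[of "z - \<tau> / 2"] by simp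
  show "theta2 (-z) \<tau> = theta2 z \<tau>"
    unfolding theta2_J using Jw[of "\<tau> / 2"] Jt[of 0] Xt by (simp add: XY_simps)
  have Xt': "p * X (z - \<tau> / 2 - 1 / 2) = - X z"
    using X_shift(4)[of "z - \<tau> / 2 - 1/2"] Xt by (simp add: minus_equation_iff[of _ "X z"])
  have "J (z + \<tau> / 2 - 1 / 2) = J (z + \<tau> / 2 + 1 / 2)"
    using J_shift(1)[of "z + \<tau> / 2 - 1 / 2"] by (simp add: add_ac)
  hence "J (- z + (\<tau> / 2 + 1 / 2)) = - X z * J (z + (\<tau> / 2 + 1 / 2))"
    using Jw[of "\<tau> / 2 + 1 / 2"] Jt[of "- 1 / 2"] Xt' by (simp add: add.assoc diff_diff_eq)
  hence J1: "J (- z + \<tau> / 2 + 1 / 2) = - X z * J (z + \<tau> / 2 + 1 / 2)" by (simp only: add.assoc)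
  show "theta1 (-z) \<tau> = - theta1 z \<tau>"
    unfolding theta1_J J1 XY_simps(6) by (simp add: XY_simps(1))
  show "theta3 (-z) \<tau> = theta3 z \<tau>" by (simp add: theta3_J J_shift)
  have "J (z - 1 / 2) = J (z + 1 / 2)" using J_shift(1)[of "z - 1 / 2"] by (simp add: add.commute)
  thus "theta4 (-z) \<tau> = theta4 z \<tau>" unfolding theta4_J using Jw[of "1 / 2"] by simp
qed

lemma theta_add_1:
  "theta1 (z + 1) \<tau> = - theta1 z \<tau>" "theta2 (z + 1) \<tau> = - theta2 z \<tau>"
  "theta3 (z + 1) \<tau> = theta3 z \<tau>" "theta4 (z + 1) \<tau> = theta4 z \<tau>"
proof -
  have J: "J (z + 1 + w) = J (z + w)" for w using J_shift(1)[of "z + w"] by (simp add: add_ac)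
  have J1: "J (z + 1 + \<tau> / 2 + 1 / 2) = J (z + \<tau> / 2 + 1 / 2)"
    using J[of "\<tau> / 2 + 1 / 2"] by (simp only: add.assoc)
  show "theta1 (z + 1) \<tau> = - theta1 z \<tau>" unfolding theta1_J J1 XY_simps(4) Y_1 by simp
  show "theta2 (z + 1) \<tau> = - theta2 z \<tau>" unfolding theta2_J J XY_simps(4) Y_1 by simp
  show "theta3 (z + 1) \<tau> = theta3 z \<tau>" unfolding theta3_J J_shift ..
  show "theta4 (z + 1) \<tau> = theta4 z \<tau>" unfolding theta4_J J ..
qed

text \<open>Up to sign all four functions acquire the same factor, so their quotients by theta1 are
  periodic or antiperiodic.\<close>

lemma theta_add_tau:
  "theta1 (z + \<tau>) \<tau> = - theta1 z \<tau> / (p * X z)" "theta2 (z + \<tau>) \<tau> = theta2 z \<tau> / (p * X z)"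
  "theta3 (z + \<tau>) \<tau> = theta3 z \<tau> / (p * X z)" "theta4 (z + \<tau>) \<tau> = - theta4 z \<tau> / (p * X z)"
proof -
  have J: "J (z + \<tau> + w) = J (z + w) / (p * X (z + w))" for w using J_shift(3)[of "z + w"] by (simp add: add_ac)
  show "theta3 (z + \<tau>) \<tau> = theta3 z \<tau> / (p * X z)" by (simp add: theta3_J J_shift)
  show "theta4 (z + \<tau>) \<tau> = - theta4 z \<tau> / (p * X z)" by (simp add: theta4_J J X_shift)
  show "theta2 (z + \<tau>) \<tau> = theta2 z \<tau> / (p * X z)" unfolding theta2_J J X_shift XY_simps(4,5) by simp
  have "J (z + \<tau> + \<tau> / 2 + 1 / 2) = - J (z + \<tau> / 2 + 1 / 2) / (p * (p * X z))"
    using J[of "\<tau> / 2 + 1 / 2"] by (simp only: add.assoc[symmetric] X_shift) simp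
  thus "theta1 (z + \<tau>) \<tau> = - theta1 z \<tau> / (p * X z)" unfolding theta1_J XY_simps(4,5) by simp
qed

lemma theta1_0: "theta1 0 \<tau> = 0"
  using theta_minus(1)[of 0] by simp

lemma lattice_theta1_eq_0:
  assumes "z \<in> lattice \<tau>" shows "theta1 z \<tau> = 0"
proof -
  \<comment> \<open>The predicate of being a zero is periodic although theta1 itself is not.\<close>
  have "(theta1 (0 + z) \<tau> = 0) = (theta1 0 \<tau> = 0)"
    by (rule periodic_lattice[of "\<lambda>z. theta1 z \<tau> = 0", OF _ _ assms]) (auto simp: theta_add_1 theta_add_tau)
  thus ?thesis by (simp add: theta1_0)
qed

lemma theta1_not_identically_0: "\<exists>z. theta1 z \<tau> \<noteq> 0"
proof (rule ccontr)
  assume *: "\<not> ?thesis"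
  have J0: "J z = 0" for z
  proof -
    have "theta1 (z - \<tau> / 2 - 1 / 2) \<tau> = 0" using * by simp
    thus ?thesis by (simp add: theta1_J)
  qed
  obtain x where x: "x \<noteq> 0" "theta_half p x + theta_half p (1 / x) \<noteq> 1"
    using theta_half_not_antisymmetric[OF norm_p] by blast
  have "X (Ln x / (2 * \<i> * of_real pi)) = x" using x(1) by (simp add: X_def)
  with J0[of "Ln x / (2 * \<i> * of_real pi)"] x(2) show False by (simp add: J_def)
qed

text \<open>The set where \<open>f\<close> is nonzero is open and contained in the countable
  lattice, while a nonempty open set contains an uncountable ball.\<close>

lemma continuous_zero_off_lattice:
  assumes "continuous_on UNIV (f :: complex \<Rightarrow> complex)" "\<And>z. z \<notin> lattice \<tau> \<Longrightarrow> f z = 0"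
  shows "f z = 0"
proof -
  have "countable (lattice \<tau>)"
  proof -
    have "lattice \<tau> = (\<lambda>(m, n). of_int m * \<tau> + of_int n) ` (UNIV :: (int \<times> int) set)"
      by (auto simp: lattice_def)
    thus ?thesis by simp
  qed
  have "open (f -` (- {0}))" by (rule open_vimage) (use assms in auto)
  moreover have "f -` (- {0}) \<subseteq> lattice \<tau>" using assms(2) by auto
  hence "countable (f -` (- {0}))" using \<open>countable (lattice \<tau>)\<close> countable_subset by blast
  ultimately have "z \<notin> f -` (- {0})" for z
    using uncountable_ball countable_subset unfolding open_contains_ball by metis
  thus ?thesis by auto
qed

text \<open>\<open>D\<close> is the product side of Jacobi's triple product, and its zeros are known
  from Euler's series. The factor \<open>Y\<close> gives \<open>N\<close> the multipliers of
  \<open>D\<close>, so \<open>N / D\<close> is elliptic, and \<open>theta1 0 \<tau> = 0\<close>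
  cancels its possible pole. Hence \<open>N = C * D\<close>, where \<open>C\<close> is nonzero
  because theta1 does not vanish identically.\<close>

lemma theta1_zeros: "theta1 z \<tau> = 0 \<longleftrightarrow> z \<in> lattice \<tau>"
  and theta1_deriv_nonzero: "deriv (\<lambda>z. theta1 z \<tau>) 0 \<noteq> 0"
proof -
  define E where "E = euler_series (p\<^sup>2)"
  define D where "D = (\<lambda>z. E (X z) * E (p\<^sup>2 / X z))"
  define H where "H = (\<lambda>z. E (p\<^sup>2 * X z) * E (p\<^sup>2 / X z))"
  define N where "N = (\<lambda>z. theta1 z \<tau> * Y z)"
  have E_hol: "(\<lambda>z. E (f z)) holomorphic_on UNIV" if "f holomorphic_on UNIV" for f
    using holomorphic_on_compose[OF that, of E] holomorphic_euler_series[OF norm_p2]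
    by (auto simp: o_def E_def intro: holomorphic_on_subset)
  have D_hol: "D holomorphic_on UNIV" "H holomorphic_on UNIV" unfolding D_def H_def
    by (intro holomorphic_intros E_hol X_holomorphic; simp)+
  have N_hol: "N holomorphic_on UNIV" unfolding N_def
    by (intro holomorphic_intros theta_holomorphic Y_holomorphic)
  \<comment> \<open>Splitting off \<open>1 - X z\<close> isolates the zero of \<open>D\<close> at
    the origin; it is simple once \<open>H 0\<close> is known to be nonzero.\<close>
  have DH: "D z = (1 - X z) * H z" for z
    unfolding D_def H_def using euler_series_rec[OF norm_p2, of "X z"] by (simp add: E_def)
  have D_shift: "D (z + 1) = D z" "D (z + \<tau>) = - D z / X z" for z
  proof -
    show "D (z + 1) = D z" by (simp add: D_def X_shift)
    have "D (z + \<tau>) = E (p\<^sup>2 * X z) * E (1 / X z)" by (simp add: D_def X_shift)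
    also have "E (1 / X z) = (1 - 1 / X z) * E (p\<^sup>2 / X z)"
      using euler_series_rec[OF norm_p2, of "1 / X z"] by (simp add: E_def)
    finally show "D (z + \<tau>) = - D z / X z" unfolding DH H_def by (simp add: field_simps)
  qed
  have D0: "z \<in> lattice \<tau>" if Dz: "D z = 0" for z
  proof -
    consider "E (X z) = 0" | "E (p\<^sup>2 / X z) = 0" using Dz by (auto simp: D_def)
    then show ?thesis
    proof cases
      case 1
      thus ?thesis by (intro euler_series_X_eq_0) (simp add: E_def)
    next
      case 2
      have "p\<^sup>2 / X z = X (- z + \<tau>)" by (simp only: X_shift) simp
      hence "- z + \<tau> \<in> lattice \<tau>" using 2 by (intro euler_series_X_eq_0) (simp add: E_def)
      thus ?thesis using lattice_closed(6)[OF lattice_closed(3)] by fastforce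
    qed
  qed
  have "E (p\<^sup>2) \<noteq> 0"
  proof
    assume "E (p\<^sup>2) = 0"
    then obtain k where "(p\<^sup>2) ^ k * p\<^sup>2 = 1" using euler_series_eq_0[OF norm_p2] unfolding E_def by blast
    hence "norm (p\<^sup>2) ^ Suc k = 1" by (metis norm_one norm_power power_Suc2)
    thus False using norm_p2
      by (metis less_irrefl nat.distinct(1) norm_ge_zero power_eq_1_iff real_norm_def abs_norm_cancel)
  qed
  hence H0: "H 0 \<noteq> 0" by (simp add: H_def XY_simps)
  have "((\<lambda>z. (1 - X z) * H z) has_field_derivative (- (2 * \<i> * of_real pi)) * H 0 + deriv H 0 * (1 - X 0)) (at 0)"
  proof (rule DERIV_mult)
    show "((\<lambda>z. 1 - X z) has_field_derivative - (2 * \<i> * of_real pi)) (at 0)"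
      unfolding X_def by (auto intro!: derivative_eq_intros)
    show "(H has_field_derivative deriv H 0) (at 0)"
      using D_hol(2) holomorphic_derivI by blast
  qed
  hence dD: "(D has_field_derivative - (2 * \<i> * of_real pi) * H 0) (at 0)"
    unfolding DH[symmetric] by (simp add: XY_simps(3))
  have dD0: "deriv D 0 \<noteq> 0" using DERIV_imp_deriv[OF dD] H0 by simp
  have "simple_pole_part (\<lambda>z. N z / D z) 0 (N 0 / deriv D 0)"
    by (rule simple_pole_part_divide) (use N_hol D_hol dD0 DH[of 0] XY_simps(3) in \<open>auto intro!: entire_analytic_at\<close>)
  hence s: "simple_pole_part (\<lambda>z. N z / D z) 0 0" by (simp add: N_def theta1_0)
  obtain C where C: "\<And>c. c \<notin> lattice \<tau> \<Longrightarrow> N c / D c = C"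
  proof (rule elliptic_constant_off_lattice[OF _ _ s])
    show "N (z + 1) / D (z + 1) = N z / D z" for z by (simp add: N_def D_shift theta_add_1 XY_simps Y_1)
    show "N (z + \<tau>) / D (z + \<tau>) = N z / D z" for z by (simp add: N_def D_shift theta_add_tau XY_simps(4,5))
    show "(\<lambda>z. N z / D z) analytic_on {c}" if "c \<notin> lattice \<tau>" for c
      using N_hol D_hol D0 that by (intro analytic_on_divide entire_analytic_at) auto
  qed blast
  have ND: "N z = C * D z" for z
  proof -
    have "N z - C * D z = 0"
    proof (rule continuous_zero_off_lattice[of "\<lambda>z. N z - C * D z"])
      show "continuous_on UNIV (\<lambda>z. N z - C * D z)"
        by (intro holomorphic_on_imp_continuous_on holomorphic_intros N_hol D_hol)
      show "N z - C * D z = 0" if "z \<notin> lattice \<tau>" for z using C[OF that] D0 that by (auto simp: field_simps)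
    qed
    thus ?thesis by simp
  qed
  have "C \<noteq> 0"
  proof
    assume "C = 0"
    hence "theta1 z \<tau> = 0" for z using ND[of z] by (simp add: N_def)
    thus False using theta1_not_identically_0 by blast
  qed
  show "theta1 z \<tau> = 0 \<longleftrightarrow> z \<in> lattice \<tau>"
  proof
    assume "theta1 z \<tau> = 0"
    hence "D z = 0" using ND[of z] \<open>C \<noteq> 0\<close> by (simp add: N_def)
    thus "z \<in> lattice \<tau>" by (rule D0)
  qed (rule lattice_theta1_eq_0)
  show "deriv (\<lambda>z. theta1 z \<tau>) 0 \<noteq> 0"
  proof
    assume "deriv (\<lambda>z. theta1 z \<tau>) 0 = 0"
    hence "((\<lambda>z. theta1 z \<tau>) has_field_derivative 0) (at 0)"
      using theta_holomorphic(1) holomorphic_derivI by (metis UNIV_I open_UNIV)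
    moreover have "(Y has_field_derivative deriv Y 0) (at 0)"
      using Y_holomorphic holomorphic_derivI by blast
    ultimately have "((\<lambda>z. theta1 z \<tau> * Y z) has_field_derivative 0 * Y 0 + deriv Y 0 * theta1 0 \<tau>) (at 0)"
      by (rule DERIV_mult)
    hence "((\<lambda>z. C * D z) has_field_derivative 0) (at 0)"
      unfolding ND[symmetric] by (simp add: N_def theta1_0)
    moreover have "((\<lambda>z. C * D z) has_field_derivative C * (- (2 * \<i> * of_real pi) * H 0)) (at 0)"
      by (rule DERIV_cmult[OF dD])
    ultimately show False using DERIV_unique H0 \<open>C \<noteq> 0\<close> by fastforce
  qed
qed

end

section \<open>Laurent expansions of the theta quotients\<close>

lemma simple_pole_part_scale:
  assumes "simple_pole_part f (w * c) s" "w \<noteq> 0"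
  shows "simple_pole_part (\<lambda>z. f (w * z)) c (s / w)"
proof -
  obtain h where h: "h analytic_on {w * c}" "\<forall>\<^sub>F z in at (w * c). f z = s / (z - w * c) + h z"
    using assms(1) by (auto simp: simple_pole_part_def)
  have "filterlim (\<lambda>z. w * z) (at (w * c)) (at c)"
    unfolding filterlim_at using assms(2)
    by (auto intro!: tendsto_eq_intros simp: eventually_at_filter)
  with h(2) have "\<forall>\<^sub>F z in at c. f (w * z) = s / (w * z - w * c) + h (w * z)"
    by (rule eventually_compose_filterlim)
  hence "\<forall>\<^sub>F z in at c. f (w * z) = s / w / (z - c) + h (w * z)"
    by (simp add: right_diff_distrib[symmetric])
  with analytic_at_scale[OF h(1)] show ?thesis by (rule simple_pole_partI)
qed

lemma lattice_coordinates:
  assumes "Im \<tau> \<noteq> 0" "of_real x * \<tau> + of_real y \<in> lattice \<tau>"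
  shows "x \<in> \<int>" "y \<in> \<int>"
proof -
  obtain m n where "of_real x * \<tau> + of_real y = of_int m * \<tau> + of_int n"
    using assms(2) by (auto simp: lattice_def)
  moreover from this have "x * Im \<tau> = of_int m * Im \<tau>" by (simp add: complex_eq_iff)
  hence x: "x = of_int m" using assms(1) by simp
  ultimately have "y = of_int n" by (simp add: complex_eq_iff)
  with x show "x \<in> \<int>" "y \<in> \<int>" by simp_all
qed

context upper_half_point
begin

text \<open>Discreteness of the lattice follows from the isolation of the zeros of theta1, whose
  zero set it is.\<close>

lemma eventually_not_lattice: "\<forall>\<^sub>F z in at c. z - q \<notin> lattice \<tau>"
proof -
  obtain z0 where z0: "theta1 z0 \<tau> \<noteq> 0" using theta1_not_identically_0 by blast
  have "\<forall>\<^sub>F z in at (c - q). theta1 z \<tau> \<noteq> 0 \<and> z \<in> UNIV"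
    by (rule non_zero_neighbour_alt[OF theta_holomorphic(1)]) (use z0 in auto)
  hence "\<forall>\<^sub>F z in at (c - q). z \<notin> lattice \<tau>"
    by eventually_elim (simp add: theta1_zeros)
  thus ?thesis unfolding filtermap_at_shift[symmetric] eventually_filtermap .
qed

lemma J_eq_0: "J z = 0 \<longleftrightarrow> z - \<tau> / 2 - 1 / 2 \<in> lattice \<tau>"
  using theta1_zeros[of "z - \<tau> / 2 - 1 / 2"] by (simp add: theta1_J)

text \<open>\<open>J\<close> is evaluated at \<open>\<tau> / 2\<close>, \<open>0\<close> and
  \<open>1 / 2\<close>, none of them congruent to its zero \<open>(\<tau> + 1) / 2\<close>.\<close>

lemma theta_null_nonzero: "theta2 0 \<tau> \<noteq> 0" "theta3 0 \<tau> \<noteq> 0" "theta4 0 \<tau> \<noteq> 0"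
proof -
  have half: "(1 / 2 :: real) \<notin> \<int>" "(- 1 / 2 :: real) \<notin> \<int>"
    using fraction_not_in_Ints[of 2 1, where ?'a = real] fraction_not_in_Ints[of 2 "-1", where ?'a = real] by simp_all
  have "Im \<tau> \<noteq> 0" using Im_pos by simp
  note * = lattice_coordinates[OF this]
  show "theta2 0 \<tau> \<noteq> 0" using *(2)[of 0 "- 1 / 2"] half by (auto simp: theta2_J J_eq_0)
  show "theta3 0 \<tau> \<noteq> 0" using *(2)[of "- 1 / 2" "- 1 / 2"] half by (auto simp: theta3_J J_eq_0)
  show "theta4 0 \<tau> \<noteq> 0" using *(1)[of "- 1 / 2" 0] half by (auto simp: theta4_J J_eq_0)
qed

definition kappa :: complex where "kappa = deriv (\<lambda>z. theta1 z \<tau>) 0"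

text \<open>The factor normalizes the residue at \<open>0\<close> to \<open>1\<close>. For \<open>\<theta> = theta2, theta3, theta4\<close> this
  is, up to scaling, the Jacobi function cs, ds, ns.\<close>

definition g :: "(complex \<Rightarrow> complex \<Rightarrow> complex) \<Rightarrow> complex \<Rightarrow> complex" where
  "g \<theta> z = kappa * \<theta> z \<tau> / (\<theta> 0 \<tau> * theta1 z \<tau>)"

lemma g_add_1: "g theta2 (z + 1) = g theta2 z" "g theta3 (z + 1) = - g theta3 z" "g theta4 (z + 1) = - g theta4 z"
  by (simp_all add: g_def theta_add_1)

lemma g_add_tau: "g theta2 (z + \<tau>) = - g theta2 z" "g theta3 (z + \<tau>) = - g theta3 z" "g theta4 (z + \<tau>) = g theta4 z"
  by (simp_all add: g_def theta_add_tau)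

lemma g2_minus: "g theta2 (- z) = - g theta2 z"
  by (simp add: g_def theta_minus)

lemma g_analytic:
  assumes "(\<lambda>z. \<theta> z \<tau>) holomorphic_on UNIV" "\<theta> 0 \<tau> \<noteq> 0" "c \<notin> lattice \<tau>"
  shows "g \<theta> analytic_on {c}"
  unfolding g_def[abs_def]
  by (intro analytic_intros entire_analytic_at assms theta_holomorphic) (use assms theta1_zeros in auto)

text \<open>An even function over the odd theta1 is odd, so the analytic part of the expansion
  vanishes at 0 and is divisible by \<open>z\<close>.\<close>

lemma g_expansion:
  assumes hol: "(\<lambda>z. \<theta> z \<tau>) holomorphic_on UNIV" and even: "\<And>z. \<theta> (- z) \<tau> = \<theta> z \<tau>"
    and nz: "\<theta> 0 \<tau> \<noteq> 0"
  obtains k where "k analytic_on {0}" "\<forall>\<^sub>F z in at 0. g \<theta> z = 1 / z + z * k z"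
proof -
  have "(\<lambda>z. kappa / \<theta> 0 \<tau> * \<theta> z \<tau>) holomorphic_on UNIV"
    by (intro holomorphic_on_mult holomorphic_on_const hol)
  hence "simple_pole_part (\<lambda>z. (kappa / \<theta> 0 \<tau> * \<theta> z \<tau>) / theta1 z \<tau>) 0
      ((kappa / \<theta> 0 \<tau> * \<theta> 0 \<tau>) / deriv (\<lambda>z. theta1 z \<tau>) 0)"
    using theta1_deriv_nonzero theta1_0
    by (intro simple_pole_part_divide entire_analytic_at theta_holomorphic)
  hence "simple_pole_part (g \<theta>) 0 1"
    using nz theta1_deriv_nonzero by (simp add: kappa_def[symmetric] g_def[abs_def])
  then obtain h where h: "h analytic_on {0}" "\<forall>\<^sub>F z in at 0. g \<theta> z = 1 / z + h z"
    by (auto simp: simple_pole_part_def)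
  have "h 0 = 0"
  proof -
    have h0: "(h \<longlongrightarrow> h 0) (at 0)" using analytic_at_imp_isCont[OF h(1)] by (simp add: isCont_def)
    have fl: "filterlim uminus (at (0::complex)) (at 0)"
      using filtermap_at_minus[of "0::complex"] by (simp add: filterlim_def)
    have "\<forall>\<^sub>F z in at 0. g \<theta> (- z) = 1 / (- z) + h (- z)"
      by (rule eventually_compose_filterlim[OF h(2) fl])
    with h(2) have ev: "\<forall>\<^sub>F z in at 0. h (- z) = - h z"
      by eventually_elim (auto simp: g_def even theta_minus algebra_simps eq_neg_iff_add_eq_0)
    have "((\<lambda>z. h (- z)) \<longlongrightarrow> h 0) (at 0)" by (rule filterlim_compose[OF h0 fl])
    moreover have "((\<lambda>z. h (- z)) \<longlongrightarrow> - h 0) (at 0)"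
    proof (rule Lim_transform_eventually)
      show "((\<lambda>z. - h z) \<longlongrightarrow> - h 0) (at 0)" by (intro tendsto_intros h0)
      show "\<forall>\<^sub>F z in at 0. - h z = h (- z)" using ev by eventually_elim simp
    qed
    ultimately have "h 0 = - h 0" by (intro tendsto_unique[of "at (0::complex)"]) auto
    thus ?thesis by simp
  qed
  then obtain k where k: "k analytic_on {0}" "\<And>z. h z = z * k z"
    using analytic_difference_quotient[OF h(1)] by (metis add_0 diff_zero)
  show thesis by (rule that[OF k(1)]) (use h(2) k(2) in simp)
qed

text \<open>Squaring removes the period signs and subtraction removes the double poles, so the
  difference is constant. The constant is read off at 0 from the expansions.\<close>

lemma g_square_diff:
  assumes "(\<lambda>z. \<theta> z \<tau>) holomorphic_on UNIV" "\<theta> 0 \<tau> \<noteq> 0"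
    and "(\<lambda>z. \<theta>' z \<tau>) holomorphic_on UNIV" "\<theta>' 0 \<tau> \<noteq> 0"
    and per: "\<And>z. (g \<theta> (z + 1))\<^sup>2 = (g \<theta> z)\<^sup>2" "\<And>z. (g \<theta> (z + \<tau>))\<^sup>2 = (g \<theta> z)\<^sup>2"
      "\<And>z. (g \<theta>' (z + 1))\<^sup>2 = (g \<theta>' z)\<^sup>2" "\<And>z. (g \<theta>' (z + \<tau>))\<^sup>2 = (g \<theta>' z)\<^sup>2"
    and k: "k analytic_on {0}" "\<forall>\<^sub>F z in at 0. g \<theta> z = 1 / z + z * k z"
    and k': "k' analytic_on {0}" "\<forall>\<^sub>F z in at 0. g \<theta>' z = 1 / z + z * k' z"
    and c: "c \<notin> lattice \<tau>"
  shows "(g \<theta> c)\<^sup>2 - (g \<theta>' c)\<^sup>2 = 2 * (k 0 - k' 0)"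
proof -
  define f where "f = (\<lambda>z. (g \<theta> z)\<^sup>2 - (g \<theta>' z)\<^sup>2)"
  define h where "h = (\<lambda>z. 2 * (k z - k' z) + z\<^sup>2 * ((k z)\<^sup>2 - (k' z)\<^sup>2))"
  have h: "h analytic_on {0}" unfolding h_def by (intro analytic_intros k k')
  have "\<forall>\<^sub>F z::complex in at 0. z \<noteq> 0" by (simp add: eventually_at_filter)
  with k(2) k'(2) have ev: "\<forall>\<^sub>F z in at 0. f z = 0 / (z - 0) + h z"
  proof eventually_elim
    case (elim z)
    have "f z = (1 / z + z * k z)\<^sup>2 - (1 / z + z * k' z)\<^sup>2" by (simp only: f_def elim)
    also have "\<dots> = h z" using elim(3) by (simp add: h_def power2_eq_square field_simps)
    finally show ?case by simp
  qed
  obtain C where C: "\<And>c. c \<notin> lattice \<tau> \<Longrightarrow> f c = C" "(f \<longlongrightarrow> C) (at 0)"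
  proof (rule elliptic_constant_off_lattice)
    show "f (z + 1) = f z" "f (z + \<tau>) = f z" for z by (simp_all add: f_def per)
    show "simple_pole_part f 0 0" by (rule simple_pole_partI[OF h ev])
    show "f analytic_on {c}" if "c \<notin> lattice \<tau>" for c
      unfolding f_def by (intro analytic_intros g_analytic assms that)
  qed blast
  have "(h \<longlongrightarrow> h 0) (at 0)" using analytic_at_imp_isCont[OF h] by (simp add: isCont_def)
  hence "(f \<longlongrightarrow> h 0) (at 0)"
    by (rule Lim_transform_eventually) (use ev in \<open>auto elim: eventually_mono\<close>)
  hence "C = h 0" using C(2) by (intro tendsto_unique[of "at (0::complex)"]) auto
  thus ?thesis using C(1)[OF c] by (simp add: f_def h_def)
qed

text \<open>Up to scaling, \<open>f\<close> is \<open>cs' + ds ns\<close>. Its double poles cancel,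
  so it is constant up to removable values; being antiperiodic under \<tau>, this constant equals
  its own negative. The limit at 0 is the sum of the three coefficients.\<close>

lemma expansion_coefficients_sum:
  assumes k2: "k2 analytic_on {0}" "\<forall>\<^sub>F z in at 0. g theta2 z = 1 / z + z * k2 z"
    and k3: "k3 analytic_on {0}" "\<forall>\<^sub>F z in at 0. g theta3 z = 1 / z + z * k3 z"
    and k4: "k4 analytic_on {0}" "\<forall>\<^sub>F z in at 0. g theta4 z = 1 / z + z * k4 z"
  shows "k2 0 + k3 0 + k4 0 = 0"
proof -
  note g2_an = g_analytic[where \<theta> = theta2, OF theta_holomorphic(2) theta_null_nonzero(1)]
  note g3_an = g_analytic[where \<theta> = theta3, OF theta_holomorphic(3) theta_null_nonzero(2)]
  note g4_an = g_analytic[where \<theta> = theta4, OF theta_holomorphic(4) theta_null_nonzero(3)]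
  \<comment> \<open>\<open>deriv\<close> is unspecified at a pole; the value 0 on the lattice makes
    the period relations hold at every point.\<close>
  define f where "f = (\<lambda>z. if z \<in> lattice \<tau> then 0 else deriv (g theta2) z + g theta3 z * g theta4 z)"
  define h where "h = (\<lambda>z. k2 z + z * deriv k2 z + k3 z + k4 z + z\<^sup>2 * (k3 z * k4 z))"
  have h: "h analytic_on {0}" unfolding h_def by (intro analytic_intros k2 k3 k4)
  have dg: "(g theta2 has_field_derivative deriv (g theta2) z) (at z)" if "z \<notin> lattice \<tau>" for z
    using g2_an[OF that] by (metis analytic_on_imp_differentiable_at DERIV_deriv_iff_field_differentiable singletonI)
  have lat: "z + 1 \<in> lattice \<tau> \<longleftrightarrow> z \<in> lattice \<tau>" "z + \<tau> \<in> lattice \<tau> \<longleftrightarrow> z \<in> lattice \<tau>" for z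
    by (simp_all add: theta1_zeros[symmetric] theta_add_1 theta_add_tau)
  have f1: "f (z + 1) = f z" for z
  proof (cases "z \<in> lattice \<tau>")
    case False
    have "((\<lambda>z. g theta2 (z + 1)) has_field_derivative deriv (g theta2) (z + 1)) (at z)"
      using dg[of "z + 1"] False by (simp add: lat DERIV_shift)
    hence "(g theta2 has_field_derivative deriv (g theta2) (z + 1)) (at z)" by (simp add: g_add_1)
    hence "deriv (g theta2) (z + 1) = deriv (g theta2) z" using dg[OF False] by (rule DERIV_unique)
    thus ?thesis by (simp add: f_def lat g_add_1)
  qed (simp add: f_def lat)
  have f2: "f (z + \<tau>) = - f z" for z
  proof (cases "z \<in> lattice \<tau>")
    case False
    have "((\<lambda>z. g theta2 (z + \<tau>)) has_field_derivative deriv (g theta2) (z + \<tau>)) (at z)"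
      using dg[of "z + \<tau>"] False by (simp add: lat DERIV_shift)
    hence "((\<lambda>z. - g theta2 z) has_field_derivative deriv (g theta2) (z + \<tau>)) (at z)" by (simp add: g_add_tau)
    moreover have "((\<lambda>z. - g theta2 z) has_field_derivative - deriv (g theta2) z) (at z)"
      by (intro DERIV_minus dg False)
    ultimately have "deriv (g theta2) (z + \<tau>) = - deriv (g theta2) z" by (rule DERIV_unique)
    thus ?thesis by (simp add: f_def lat g_add_tau)
  qed (simp add: f_def lat)
  have ev: "\<forall>\<^sub>F z in at 0. f z = 0 / (z - 0) + h z"
  proof -
    obtain e1 where e1: "e1 > 0" "k2 holomorphic_on ball 0 e1" using k2(1) by (auto simp: analytic_on_def)
    obtain e2 where e2: "e2 > 0" "\<And>z. z \<noteq> 0 \<Longrightarrow> dist z 0 < e2 \<Longrightarrow> g theta2 z = 1 / z + z * k2 z"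
      using k2(2) unfolding eventually_at by auto
    define U where "U = ball 0 (min e1 e2) - {0::complex}"
    have U: "open U" unfolding U_def by auto
    have dU: "deriv (g theta2) z = - 1 / z\<^sup>2 + (k2 z + z * deriv k2 z)" if z: "z \<in> U" for z
    proof (rule DERIV_imp_deriv, rule has_field_derivative_transform_within_open[OF _ U z])
      have "(k2 has_field_derivative deriv k2 z) (at z)"
        using e1(2) z by (intro holomorphic_derivI[of k2 "ball 0 e1"]) (auto simp: U_def)
      thus "((\<lambda>z. 1 / z + z * k2 z) has_field_derivative - 1 / z\<^sup>2 + (k2 z + z * deriv k2 z)) (at z)"
        using z by (auto intro!: derivative_eq_intros simp: U_def power2_eq_square)
      show "1 / z + z * k2 z = g theta2 z" if "z \<in> U" for z using e2(2)[of z] that by (auto simp: U_def)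
    qed
    have "\<forall>\<^sub>F z in at 0. z \<in> U"
      unfolding eventually_at U_def using e1 e2 by (intro exI[of _ "min e1 e2"]) (auto simp: dist_commute)
    with k3(2) k4(2) eventually_not_lattice[of 0 0] show ?thesis
    proof eventually_elim
      case (elim z)
      have "z \<noteq> 0" using elim(4) by (simp add: U_def)
      have "f z = - 1 / z\<^sup>2 + (k2 z + z * deriv k2 z) + (1 / z + z * k3 z) * (1 / z + z * k4 z)"
        using elim dU[OF elim(4)] by (simp add: f_def)
      also have "\<dots> = h z" using \<open>z \<noteq> 0\<close> by (simp add: h_def power2_eq_square field_simps)
      finally show ?case by simp
    qed
  qed
  have spp: "simple_pole_part f c 0" for c
  proof (cases "c \<in> lattice \<tau>")
    case True
    show ?thesis
      using simple_pole_part_antiperiodic_lattice[of f \<tau> c 0, OF f1 f2 True simple_pole_partI[OF h ev]] by simp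
  next
    case False
    have "(\<lambda>z. deriv (g theta2) z + g theta3 z * g theta4 z) analytic_on {c}"
      by (intro analytic_intros g2_an g3_an g4_an False)
    hence "simple_pole_part (\<lambda>z. deriv (g theta2) z + g theta3 z * g theta4 z) c 0"
      by (rule simple_pole_part_analytic)
    moreover have "\<forall>\<^sub>F z in at c. f z = deriv (g theta2) z + g theta3 z * g theta4 z"
      using eventually_not_lattice[of 0 c] by (auto simp: f_def elim: eventually_mono)
    ultimately show ?thesis by (rule simple_pole_part_cong)
  qed
  have "f (z + 2 * \<tau>) = f z" for z using f2[of z] f2[of "z + \<tau>"] by (simp add: add_ac)
  then obtain C where C: "\<And>c. (f \<longlongrightarrow> C) (at c)"
    using elliptic_removable_constant[of "2 * \<tau>" f, OF Im_period spp f1] by metis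
  have "((\<lambda>z. f (z + \<tau>)) \<longlongrightarrow> C) (at (\<tau> - \<tau>))" by (rule LIM_offset[OF C])
  hence "((\<lambda>z. - f z) \<longlongrightarrow> C) (at 0)" by (simp add: f2)
  moreover have "((\<lambda>z. - f z) \<longlongrightarrow> - C) (at 0)" by (intro tendsto_intros C)
  ultimately have "C = - C" by (intro tendsto_unique[of "at (0::complex)"]) auto
  hence "C = 0" by simp
  have "(h \<longlongrightarrow> h 0) (at 0)" using analytic_at_imp_isCont[OF h] by (simp add: isCont_def)
  hence "(f \<longlongrightarrow> h 0) (at 0)"
    by (rule Lim_transform_eventually) (use ev in \<open>auto elim: eventually_mono\<close>)
  hence "C = h 0" using C by (intro tendsto_unique[of "at (0::complex)"]) auto
  thus ?thesis using \<open>C = 0\<close> by (simp add: h_def)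
qed

text \<open>By Jacobi's formula for \<open>kappa\<close> this number is
  \<open>1 / (2 * ell_K \<tau>)\<close>, the residue of cs(2Kz) at 0.\<close>

definition cs_scale :: complex where
  "cs_scale = theta4 0 \<tau> * theta2 0 \<tau> / (theta3 0 \<tau> * kappa)"

lemma jacobi_cs_g: "jacobi_cs \<tau> (2 * ell_K \<tau> * z) = cs_scale * g theta2 z"
proof -
  have "kappa \<noteq> 0" using theta1_deriv_nonzero by (simp add: kappa_def)
  moreover have "2 * ell_K \<tau> * z / (2 * ell_K \<tau>) = z" using theta_null_nonzero by (simp add: ell_K_def)
  ultimately show ?thesis using theta_null_nonzero by (simp add: jacobi_cs_def cs_scale_def g_def)
qed

text \<open>The identity \<open>theta3 0 \<tau> ^ 4 = theta2 0 \<tau> ^ 4 + theta4 0 \<tau> ^ 4\<close> expresses that the three constant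
  differences of the squares of \<open>g theta2\<close>, \<open>g theta3\<close>, \<open>g theta4\<close> add up to zero.\<close>

lemma expansions:
  obtains k2 k3 k4 where
    "k2 analytic_on {0}" "\<forall>\<^sub>F z in at 0. g theta2 z = 1 / z + z * k2 z"
    "k3 analytic_on {0}" "\<forall>\<^sub>F z in at 0. g theta3 z = 1 / z + z * k3 z"
    "k4 analytic_on {0}" "\<forall>\<^sub>F z in at 0. g theta4 z = 1 / z + z * k4 z"
    "k2 0 + k3 0 + k4 0 = 0"
    "cs_scale\<^sup>2 * k2 0 = - (1/3 - 1/6 * mod_lambda \<tau>)"
    "theta3 0 \<tau> ^ 4 = theta2 0 \<tau> ^ 4 + theta4 0 \<tau> ^ 4"
proof -
  note nz = theta_null_nonzero
  note hol = theta_holomorphic(2-4)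
  obtain k2 where k2: "k2 analytic_on {0}" "\<forall>\<^sub>F z in at 0. g theta2 z = 1 / z + z * k2 z"
    using g_expansion[where \<theta> = theta2, OF hol(1) theta_minus(2) nz(1)] by blast
  obtain k3 where k3: "k3 analytic_on {0}" "\<forall>\<^sub>F z in at 0. g theta3 z = 1 / z + z * k3 z"
    using g_expansion[where \<theta> = theta3, OF hol(2) theta_minus(3) nz(2)] by blast
  obtain k4 where k4: "k4 analytic_on {0}" "\<forall>\<^sub>F z in at 0. g theta4 z = 1 / z + z * k4 z"
    using g_expansion[where \<theta> = theta4, OF hol(3) theta_minus(4) nz(3)] by blast
  have sum0: "k2 0 + k3 0 + k4 0 = 0" by (rule expansion_coefficients_sum[OF k2 k3 k4])
  have half: "(1 / 2 :: real) \<notin> \<int>"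
    using fraction_not_in_Ints[of 2 1, where ?'a = real] by simp
  have "Im \<tau> \<noteq> 0" using Im_pos by simp
  note * = lattice_coordinates[OF this]
  \<comment> \<open>The points \<open>1 / 2\<close> and \<open>\<tau> / 2 + 1 / 2\<close> are zeros
    of theta2 and theta3, so each difference of squares evaluated there reduces to a single
    square.\<close>
  have w1: "1 / 2 \<notin> lattice \<tau>" using *(2)[of 0 "1 / 2"] half by auto
  have w2: "\<tau> / 2 + 1 / 2 \<notin> lattice \<tau>" using *(2)[of "1 / 2" "1 / 2"] half by auto
  define t2 where "t2 = theta2 0 \<tau>"
  define t3 where "t3 = theta3 0 \<tau>"
  define t4 where "t4 = theta4 0 \<tau>"
  have t: "t2 \<noteq> 0" "t3 \<noteq> 0" "t4 \<noteq> 0" using nz by (simp_all add: t2_def t3_def t4_def)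
  have kap: "kappa \<noteq> 0" using theta1_deriv_nonzero by (simp add: kappa_def)
  have J0: "J (\<tau> / 2 + 1 / 2) = 0" by (simp add: J_eq_0 lattice_closed)
  have th1: "theta1 (1 / 2) \<tau> = t2"
  proof -
    have "J (1 / 2 + \<tau> / 2 + 1 / 2) = J (\<tau> / 2)" using J_shift(1)[of "\<tau> / 2"] by (simp add: add_ac)
    thus ?thesis unfolding theta1_J t2_def theta2_J by (simp add: Y_half XY_simps(2) mult_ac)
  qed
  have th2: "theta2 (1 / 2) \<tau> = 0" unfolding theta2_J using J0 by (simp add: add.commute)
  have th3: "theta3 (1 / 2) \<tau> = t4" by (simp add: theta3_J t4_def theta4_J)
  have th4: "theta4 (1 / 2) \<tau> = t3" using J_shift(1)[of 0] by (simp add: theta4_J t3_def theta3_J)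
  have th3': "theta3 (\<tau> / 2 + 1 / 2) \<tau> = 0" by (simp add: theta3_J J0)
  have th4': "theta4 (\<tau> / 2 + 1 / 2) \<tau> = t2 / r"
    using J_shift(1)[of "\<tau> / 2"] by (simp add: theta4_J t2_def theta2_J XY_simps(2) add_ac)
  have th1': "theta1 (\<tau> / 2 + 1 / 2) \<tau> = t3 / r"
  proof -
    have "J (\<tau> / 2 + 1 / 2 + \<tau> / 2 + 1 / 2) = J (0 + \<tau> + 1)" by (rule arg_cong[of _ _ J]) simp
    also have "\<dots> = t3 / p" unfolding J_shift by (simp add: t3_def theta3_J XY_simps(3))
    finally have "theta1 (\<tau> / 2 + 1 / 2) \<tau> = - \<i> * r * (r * r * \<i>) * (t3 / p)"
      unfolding theta1_J XY_simps(4) Y_half Y_half_tau by simp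
    also have "\<dots> = t3 / r" unfolding p_r by (simp add: power4_eq_xxxx)
    finally show ?thesis .
  qed
  have g1: "g theta2 (1 / 2) = 0" "g theta3 (1 / 2) = kappa * t4 / (t3 * t2)" "g theta4 (1 / 2) = kappa * t3 / (t4 * t2)"
    "g theta3 (\<tau> / 2 + 1 / 2) = 0" "g theta4 (\<tau> / 2 + 1 / 2) = kappa * t2 / (t4 * t3)"
    by (simp_all add: g_def th1 th2 th3 th4 th1' th3' th4' t2_def[symmetric] t3_def[symmetric] t4_def[symmetric])
  have "(g theta2 (1 / 2))\<^sup>2 - (g theta3 (1 / 2))\<^sup>2 = 2 * (k2 0 - k3 0)"
    by (rule g_square_diff[where \<theta> = theta2 and \<theta>' = theta3, OF hol(1) nz(1) hol(2) nz(2) _ _ _ _ k2 k3 w1]) (simp_all add: g_add_1 g_add_tau)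
  hence d23: "2 * (k2 0 - k3 0) = - (kappa * t4 / (t3 * t2))\<^sup>2" by (simp add: g1)
  have "(g theta2 (1 / 2))\<^sup>2 - (g theta4 (1 / 2))\<^sup>2 = 2 * (k2 0 - k4 0)"
    by (rule g_square_diff[where \<theta> = theta2 and \<theta>' = theta4, OF hol(1) nz(1) hol(3) nz(3) _ _ _ _ k2 k4 w1]) (simp_all add: g_add_1 g_add_tau)
  hence d24: "2 * (k2 0 - k4 0) = - (kappa * t3 / (t4 * t2))\<^sup>2" by (simp add: g1)
  have "(g theta3 (\<tau> / 2 + 1 / 2))\<^sup>2 - (g theta4 (\<tau> / 2 + 1 / 2))\<^sup>2 = 2 * (k3 0 - k4 0)"
    by (rule g_square_diff[where \<theta> = theta3 and \<theta>' = theta4, OF hol(2) nz(2) hol(3) nz(3) _ _ _ _ k3 k4 w2]) (simp_all add: g_add_1 g_add_tau)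
  hence d34: "2 * (k3 0 - k4 0) = - (kappa * t2 / (t4 * t3))\<^sup>2" by (simp add: g1)
  \<comment> \<open>With this common factor, the difference for two of the theta functions is
    \<open>- M\<close> times the fourth power of the third null value.\<close>
  define M where "M = kappa\<^sup>2 / (t2\<^sup>2 * t3\<^sup>2 * t4\<^sup>2)"
  have M: "M \<noteq> 0" using t kap by (simp add: M_def)
  have d: "2 * (k2 0 - k3 0) = - M * t4 ^ 4" "2 * (k2 0 - k4 0) = - M * t3 ^ 4" "2 * (k3 0 - k4 0) = - M * t2 ^ 4"
    unfolding d23 d24 d34 M_def using t by (simp_all add: field_simps power2_eq_square power4_eq_xxxx)
  have "2 * (k2 0 - k4 0) = 2 * (k2 0 - k3 0) + 2 * (k3 0 - k4 0)" by simp
  hence "- (M * t3 ^ 4) = - (M * (t2 ^ 4 + t4 ^ 4))" unfolding d by (simp add: distrib_left)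
  hence "M * t3 ^ 4 = M * (t2 ^ 4 + t4 ^ 4)" by (simp only: neg_equal_iff_equal)
  hence quart: "t3 ^ 4 = t2 ^ 4 + t4 ^ 4" using M by simp
  \<comment> \<open>The differences determine the coefficients up to a common summand, which
    \<open>sum0\<close> fixes.\<close>
  have "6 * k2 0 = 2 * (k2 0 - k3 0) + 2 * (k2 0 - k4 0) + 2 * (k2 0 + k3 0 + k4 0)" by (simp add: algebra_simps)
  hence B: "6 * k2 0 = - M * (t4 ^ 4 + t3 ^ 4)" unfolding d sum0 by (simp add: algebra_simps)
  \<comment> \<open>The unevaluated derivative \<open>kappa\<close> cancels here.\<close>
  have sM: "cs_scale\<^sup>2 * M = 1 / t3 ^ 4"
    unfolding cs_scale_def M_def t2_def[symmetric] t3_def[symmetric] t4_def[symmetric]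
    using t kap by (simp add: field_simps power2_eq_square power4_eq_xxxx)
  have "6 * (cs_scale\<^sup>2 * k2 0) = cs_scale\<^sup>2 * (6 * k2 0)" by (rule mult.left_commute)
  also have "\<dots> = - (cs_scale\<^sup>2 * M) * (t4 ^ 4 + t3 ^ 4)"
    unfolding B by (simp only: mult.assoc mult_minus_left mult_minus_right)
  also have "\<dots> = - 6 * (1/3 - 1/6 * (t2 ^ 4 / t3 ^ 4))"
  proof -
    have "- (1 / u) * ((u - v) + u) = - 6 * (1/3 - 1/6 * (v / u))" if "u \<noteq> 0" for u v :: complex
      using that by (simp add: field_simps)
    moreover have "t4 ^ 4 = t3 ^ 4 - t2 ^ 4" by (simp add: quart)
    moreover have "t3 ^ 4 \<noteq> 0" using t by simp
    ultimately show ?thesis unfolding sM by (simp only:)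
  qed
  also have "t2 ^ 4 / t3 ^ 4 = mod_lambda \<tau>"
    unfolding mod_lambda_def ell_modulus_def t2_def t3_def by (simp add: power_divide flip: power_mult)
  finally have "6 * (cs_scale\<^sup>2 * k2 0) = 6 * - (1/3 - 1/6 * mod_lambda \<tau>)"
    by (simp only: mult_minus_left mult_minus_right)
  hence "cs_scale\<^sup>2 * k2 0 = - (1/3 - 1/6 * mod_lambda \<tau>)"
    by (simp only: mult_cancel_left) simp
  from that[OF k2 k3 k4 sum0 this] quart show thesis by (simp add: t2_def t3_def t4_def)
qed

section \<open>The logarithmic derivative of theta1 and the sum of residues\<close>

definition Z :: "complex \<Rightarrow> complex" where
  "Z z = deriv (\<lambda>z. theta1 z \<tau>) z / theta1 z \<tau>"

lemma theta1_DERIV: "((\<lambda>z. theta1 z \<tau>) has_field_derivative deriv (\<lambda>z. theta1 z \<tau>) z) (at z)"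
  using theta_holomorphic(1) holomorphic_derivI by blast

lemma theta1_deriv_add_1: "deriv (\<lambda>z. theta1 z \<tau>) (z + 1) = - deriv (\<lambda>z. theta1 z \<tau>) z"
proof -
  have "((\<lambda>z. theta1 (z + 1) \<tau>) has_field_derivative deriv (\<lambda>z. theta1 z \<tau>) (z + 1)) (at z)"
    using theta1_DERIV[of "z + 1"] by (simp only: DERIV_shift)
  hence "((\<lambda>z. - theta1 z \<tau>) has_field_derivative deriv (\<lambda>z. theta1 z \<tau>) (z + 1)) (at z)"
    by (simp add: theta_add_1)
  moreover have "((\<lambda>z. - theta1 z \<tau>) has_field_derivative - deriv (\<lambda>z. theta1 z \<tau>) z) (at z)"
    by (intro DERIV_minus theta1_DERIV)
  ultimately show ?thesis by (rule DERIV_unique)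
qed

lemma theta1_deriv_add_tau:
  "deriv (\<lambda>z. theta1 z \<tau>) (z + \<tau>) = - (deriv (\<lambda>z. theta1 z \<tau>) z - 2 * \<i> * of_real pi * theta1 z \<tau>) / (p * X z)"
proof -
  have "((\<lambda>z. theta1 (z + \<tau>) \<tau>) has_field_derivative deriv (\<lambda>z. theta1 z \<tau>) (z + \<tau>)) (at z)"
    using theta1_DERIV[of "z + \<tau>"] by (simp only: DERIV_shift)
  hence "((\<lambda>z. - theta1 z \<tau> / (p * X z)) has_field_derivative deriv (\<lambda>z. theta1 z \<tau>) (z + \<tau>)) (at z)"
    by (simp add: theta_add_tau)
  moreover have dX: "(X has_field_derivative 2 * \<i> * of_real pi * X z) (at z)"
    unfolding X_def[abs_def] by (auto intro!: derivative_eq_intros)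
  have "((\<lambda>z. - theta1 z \<tau> / (p * X z)) has_field_derivative
      - (deriv (\<lambda>z. theta1 z \<tau>) z - 2 * \<i> * of_real pi * theta1 z \<tau>) / (p * X z)) (at z)"
    by (auto intro!: derivative_eq_intros theta1_DERIV dX simp: field_simps)
  ultimately show ?thesis by (rule DERIV_unique)
qed

lemma Z_add_1: "Z (z + 1) = Z z"
  by (simp add: Z_def theta1_deriv_add_1 theta_add_1)

lemma Z_add_tau: "z \<notin> lattice \<tau> \<Longrightarrow> Z (z + \<tau>) = Z z - 2 * \<i> * of_real pi"
  unfolding Z_def theta1_deriv_add_tau theta_add_tau by (simp add: theta1_zeros[symmetric] field_simps)

lemma simple_pole_part_Z: "simple_pole_part Z c (if c \<in> lattice \<tau> then 1 else 0)"
proof -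
  have hol: "deriv (\<lambda>z. theta1 z \<tau>) holomorphic_on UNIV"
    using theta_holomorphic(1) by (auto intro: holomorphic_deriv)
  show ?thesis
  proof (cases "c \<in> lattice \<tau>")
    case True
    \<comment> \<open>Being a simple zero is a periodic predicate, which carries simplicity from 0
      to the whole lattice.\<close>
    define P where "P = (\<lambda>z. theta1 z \<tau> = 0 \<and> deriv (\<lambda>z. theta1 z \<tau>) z \<noteq> 0)"
    have "P (0 + c) = P 0"
      by (rule periodic_lattice[OF _ _ True])
         (auto simp: P_def theta_add_1 theta_add_tau theta1_deriv_add_1 theta1_deriv_add_tau)
    hence "P c" using theta1_0 theta1_deriv_nonzero by (simp add: P_def)
    hence "simple_pole_part Z c (deriv (\<lambda>z. theta1 z \<tau>) c / deriv (\<lambda>z. theta1 z \<tau>) c)"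
      unfolding Z_def[abs_def] P_def
      by (intro simple_pole_part_divide entire_analytic_at hol theta_holomorphic) auto
    thus ?thesis using True \<open>P c\<close> by (simp add: P_def)
  next
    case False
    have "Z analytic_on {c}" unfolding Z_def[abs_def]
      by (intro analytic_on_divide entire_analytic_at hol theta_holomorphic) (use False theta1_zeros in auto)
    thus ?thesis using False by (simp add: simple_pole_part_analytic)
  qed
qed

text \<open>\<open>Z\<close> has residue 1 at the lattice points and drops by
  \<open>2 * \<i> * \<pi>\<close> under \<tau>. Subtracting its multiples by \<open>res i\<close>,
  translated to the points \<open>pt i\<close>, cancels every pole and leaves an increment
  proportional to the sum of the residues. Incongruence of the points modulo the lattice prevents a
  pole from being cancelled twice.\<close>

lemma sum_residues_elliptic:
  assumes F: "\<And>z. F (z + 1) = F z" "\<And>z. F (z + \<tau>) = F z"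
    and I: "finite I" "\<And>i j. i \<in> I \<Longrightarrow> j \<in> I \<Longrightarrow> pt i - pt j \<in> lattice \<tau> \<Longrightarrow> i = j"
    and pole: "\<And>i. i \<in> I \<Longrightarrow> simple_pole_part F (pt i) (res i)"
    and other: "\<And>c. (\<And>i. i \<in> I \<Longrightarrow> c - pt i \<notin> lattice \<tau>) \<Longrightarrow> simple_pole_part F c 0"
  shows "(\<Sum>i\<in>I. res i) = 0"
proof -
  define G where "G = (\<lambda>z. F z - (\<Sum>i\<in>I. res i * Z (z + (- pt i))))"
  have "simple_pole_part G c 0" for c
  proof -
    have "simple_pole_part F c (\<Sum>i\<in>I. res i * (if c + - pt i \<in> lattice \<tau> then 1 else 0))"
    proof (cases "\<exists>i\<in>I. c - pt i \<in> lattice \<tau>")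
      case True
      then obtain i where i: "i \<in> I" "c - pt i \<in> lattice \<tau>" by blast
      have "(c + - pt j \<in> lattice \<tau>) = (j = i)" if "j \<in> I" for j
      proof
        assume "c + - pt j \<in> lattice \<tau>"
        from lattice_closed(6)[OF this i(2)] have "pt i - pt j \<in> lattice \<tau>" by simp
        thus "j = i" using I(2) i(1) that by metis
      qed (use i in simp)
      hence "(\<Sum>j\<in>I. res j * (if c + - pt j \<in> lattice \<tau> then 1 else 0)) = (\<Sum>j\<in>I. if j = i then res j else 0)"
        by (intro sum.cong) auto
      also have "\<dots> = res i" using i I by simp
      finally show ?thesis
        using simple_pole_part_lattice[OF F i(2) pole[OF i(1)]] by simp
    next
      case False
      hence "(\<Sum>i\<in>I. res i * (if c + - pt i \<in> lattice \<tau> then 1 else 0)) = 0"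
        by (intro sum.neutral) auto
      thus ?thesis using other[of c] False by auto
    qed
    moreover have "simple_pole_part (\<lambda>z. \<Sum>i\<in>I. res i * Z (z + (- pt i))) c
        (\<Sum>i\<in>I. res i * (if c + - pt i \<in> lattice \<tau> then 1 else 0))"
      by (intro simple_pole_part_sum simple_pole_part_cmult simple_pole_part_shift simple_pole_part_Z)
    ultimately show ?thesis unfolding G_def using simple_pole_part_diff by fastforce
  qed
  moreover have "G (z + 1) = G z" for z
  proof -
    have "z + 1 + - pt i = (z + - pt i) + 1" for i by simp
    thus ?thesis unfolding G_def F by (simp only: Z_add_1)
  qed
  moreover have "\<forall>\<^sub>F z in at c. G (z + \<tau>) = G z + (\<Sum>i\<in>I. res i * (2 * \<i> * of_real pi))" for c
  proof -
    have "\<forall>\<^sub>F z in at c. \<forall>i\<in>I. z - pt i \<notin> lattice \<tau>"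
      by (intro eventually_ball_finite I ballI eventually_not_lattice)
    thus ?thesis
    proof eventually_elim
      case (elim z)
      have "res i * Z (z + \<tau> + - pt i) = res i * Z (z + - pt i) - res i * (2 * \<i> * of_real pi)" if "i \<in> I" for i
      proof -
        have "Z (z + - pt i + \<tau>) = Z (z + - pt i) - 2 * \<i> * of_real pi"
          using elim that by (intro Z_add_tau) simp
        moreover have "z + \<tau> + - pt i = z + - pt i + \<tau>" by simp
        ultimately show ?thesis by (simp only: right_diff_distrib)
      qed
      hence "(\<Sum>i\<in>I. res i * Z (z + \<tau> + - pt i))
        = (\<Sum>i\<in>I. res i * Z (z + - pt i)) - (\<Sum>i\<in>I. res i * (2 * \<i> * of_real pi))"
        by (simp only: sum_subtractf[symmetric]) (intro sum.cong, auto)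
      thus ?case by (simp add: G_def F)
    qed
  qed
  ultimately have "(\<Sum>i\<in>I. res i * (2 * \<i> * of_real pi)) = 0"
    by (rule quasi_period_zero[OF Im_pos])
  thus ?thesis by (simp flip: sum_distrib_right)
qed

end

section \<open>The reciprocity law\<close>

definition grid :: "int \<Rightarrow> (int \<times> int) set" where
  "grid n = {0..n - 1} \<times> {0..n - 1} - {(0, 0)}"

text \<open>A sign defined for all integers: translations by lattice points produce negative
  \<open>m\<close>, for which \<open>(-1) ^ nat m\<close> would always be 1.\<close>

definition even_sign :: "int \<Rightarrow> complex" where
  "even_sign m = (if even m then 1 else -1)"

lemma finite_grid: "finite (grid n)"
  by (simp add: grid_def)

context upper_half_point
begin

abbreviation div_point :: "int \<Rightarrow> int \<Rightarrow> int \<Rightarrow> complex" where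
  "div_point n \<mu> \<nu> \<equiv> (of_int \<mu> * \<tau> + of_int \<nu>) / of_int n"

lemma division_point_in_lattice:
  assumes "n > 0" "div_point n \<mu> \<nu> \<in> lattice \<tau>"
  shows "n dvd \<mu>" "n dvd \<nu>"
proof -
  have "div_point n \<mu> \<nu> = of_real (of_int \<mu> / of_int n) * \<tau> + of_real (of_int \<nu> / of_int n)"
    by (simp add: add_divide_distrib)
  with assms(2) have "of_real (of_int \<mu> / of_int n) * \<tau> + of_real (of_int \<nu> / of_int n) \<in> lattice \<tau>" by simp
  moreover have "Im \<tau> \<noteq> 0" using Im_pos by simp
  ultimately have "(of_int \<mu> / of_int n :: real) \<in> \<int>" "(of_int \<nu> / of_int n :: real) \<in> \<int>"
    using lattice_coordinates by blast+
  thus "n dvd \<mu>" "n dvd \<nu>" using assms(1) by (auto simp: of_int_div_of_int_in_Ints_iff)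
qed

lemma grid_eq_of_lattice:
  assumes "n > 0" "(\<mu>, \<nu>) \<in> grid n \<union> {(0, 0)}" "(\<mu>', \<nu>') \<in> grid n \<union> {(0, 0)}"
    and "div_point n \<mu> \<nu> - div_point n \<mu>' \<nu>' \<in> lattice \<tau>"
  shows "\<mu> = \<mu>' \<and> \<nu> = \<nu>'"
proof -
  have "div_point n \<mu> \<nu> - div_point n \<mu>' \<nu>' = div_point n (\<mu> - \<mu>') (\<nu> - \<nu>')"
    by (simp add: diff_divide_distrib[symmetric] algebra_simps)
  with assms(4) have dvd: "n dvd \<mu> - \<mu>'" "n dvd \<nu> - \<nu>'"
    using division_point_in_lattice[OF assms(1)] by metis+
  have eq: "x = y" if "n dvd x - y" "0 \<le> x" "x < n" "0 \<le> y" "y < n" for x y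
  proof -
    have "x mod n = y mod n" using that(1) by (simp add: mod_eq_dvd_iff)
    with that show ?thesis by simp
  qed
  have "0 \<le> \<mu> \<and> \<mu> < n \<and> 0 \<le> \<nu> \<and> \<nu> < n" "0 \<le> \<mu>' \<and> \<mu>' < n \<and> 0 \<le> \<nu>' \<and> \<nu>' < n"
    using assms(1-3) by (auto simp: grid_def)
  thus ?thesis by (metis eq dvd)
qed

lemma grid_not_lattice:
  assumes "n > 0" "(\<mu>, \<nu>) \<in> grid n"
  shows "div_point n \<mu> \<nu> \<notin> lattice \<tau>"
proof
  assume "div_point n \<mu> \<nu> \<in> lattice \<tau>"
  hence "\<mu> = 0 \<and> \<nu> = 0"
    using assms by (intro grid_eq_of_lattice[of n \<mu> \<nu> 0 0]) simp_all
  thus False using assms(2) by (simp add: grid_def)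
qed

lemma of_int_mult_lattice: "w \<in> lattice \<tau> \<Longrightarrow> of_int m * w \<in> lattice \<tau>"
proof -
  assume "w \<in> lattice \<tau>"
  then obtain k l where "w = of_int k * \<tau> + of_int l" by (auto simp: lattice_def)
  thus ?thesis using lattice_closed(7)[of "m * k" \<tau> "m * l"] by (simp add: algebra_simps)
qed

text \<open>By Bezout's identity. Hence cs(2Kaz) and cs(2Kbz) share no pole off the lattice, and all
  poles of the triple product there are simple.\<close>

lemma coprime_lattice:
  assumes "coprime a b" "of_int a * w \<in> lattice \<tau>" "of_int b * w \<in> lattice \<tau>"
  shows "w \<in> lattice \<tau>"
proof -
  obtain u v where "u * a + v * b = 1" using assms(1) by (metis bezout_int coprime_iff_gcd_eq_1)
  hence "w = of_int (u * a + v * b) * w" by simp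
  also have "\<dots> = of_int u * (of_int a * w) + of_int v * (of_int b * w)" by (simp add: algebra_simps)
  also have "\<dots> \<in> lattice \<tau>" by (intro lattice_closed of_int_mult_lattice assms)
  finally show ?thesis .
qed

lemma g2_lattice: "g theta2 (z + (of_int m * \<tau> + of_int n)) = even_sign m * g theta2 z"
  unfolding even_sign_def by (rule antiperiodic_lattice) (rule g_add_1 g_add_tau)+

lemma g2_lattice_mult: "g theta2 (of_int a * (z + (of_int m * \<tau> + of_int n))) = even_sign (a * m) * g theta2 (of_int a * z)"
  using g2_lattice[of "of_int a * z" "a * m" "a * n"] by (simp add: algebra_simps)

lemma simple_pole_part_g2_0: "simple_pole_part (g theta2) 0 1"
proof -
  obtain k where k: "k analytic_on {0}" "\<forall>\<^sub>F z in at 0. g theta2 z = 1 / z + z * k z"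
    using g_expansion[where \<theta> = theta2, OF theta_holomorphic(2) theta_minus(2) theta_null_nonzero(1)] by blast
  show ?thesis by (rule simple_pole_partI[of "\<lambda>z. z * k z"]) (use k in \<open>auto intro: analytic_intros\<close>)
qed

text \<open>The residue 1 at 0 is carried to \<open>\<mu> * \<tau> + \<nu>\<close> with the
  antiperiodicity sign, and scaling divides it by \<open>n\<close>. The alternating sign in the
  Dedekind sum originates here.\<close>

lemma simple_pole_part_g2_scaled:
  assumes "n > 0"
  shows "simple_pole_part (\<lambda>z. g theta2 (of_int n * z)) (div_point n \<mu> \<nu>) (even_sign \<mu> / of_int n)"
proof -
  let ?w = "of_int \<mu> * \<tau> + of_int \<nu>"
  have "simple_pole_part (\<lambda>z. even_sign \<mu> * g theta2 (z + - ?w)) ?w (even_sign \<mu> * 1)"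
    by (intro simple_pole_part_cmult simple_pole_part_shift) (simp add: simple_pole_part_g2_0)
  moreover have "even_sign \<mu> * g theta2 (z + - ?w) = g theta2 z" for z
    using g2_lattice[of "z + - ?w" \<mu> \<nu>] by simp
  ultimately have "simple_pole_part (g theta2) ?w (even_sign \<mu>)" by simp
  hence "simple_pole_part (g theta2) (of_int n * (?w / of_int n)) (even_sign \<mu>)" using assms by simp
  thus ?thesis by (rule simple_pole_part_scale) (use assms in simp)
qed

definition psum :: "int \<Rightarrow> int \<Rightarrow> complex" where
  "psum a b = (\<Sum>(\<mu>, \<nu>)\<in>grid b. even_sign \<mu> * g theta2 (of_int a * div_point b \<mu> \<nu>) * g theta2 (div_point b \<mu> \<nu>))"

lemma ell_dedekind_sum_psum:
  "4 * of_int b * ell_dedekind_sum \<tau> a b = cs_scale\<^sup>2 * psum a b" if "b > 0"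
proof -
  have sgn: "(-1) ^ nat \<mu> = even_sign \<mu>" if "\<mu> \<ge> 0" for \<mu>
    using that by (auto simp: even_sign_def uminus_power_if even_nat_iff)
  have "4 * of_int b * ell_dedekind_sum \<tau> a b = (\<Sum>(\<mu>, \<nu>)\<in>grid b.
        (-1) ^ nat \<mu>
        * jacobi_cs \<tau> (2 * ell_K \<tau> * of_int a * div_point b \<mu> \<nu>)
        * jacobi_cs \<tau> (2 * ell_K \<tau> * div_point b \<mu> \<nu>))"
    using that by (simp add: ell_dedekind_sum_def grid_def)
  also have "\<dots> = (\<Sum>(\<mu>, \<nu>)\<in>grid b. cs_scale\<^sup>2 * (even_sign \<mu> * g theta2 (of_int a * div_point b \<mu> \<nu>) * g theta2 (div_point b \<mu> \<nu>)))"
  proof (intro sum.cong refl, clarify)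
    fix \<mu> \<nu> assume "(\<mu>, \<nu>) \<in> grid b"
    hence "\<mu> \<ge> 0" by (auto simp: grid_def)
    show "(-1) ^ nat \<mu> * jacobi_cs \<tau> (2 * ell_K \<tau> * of_int a * div_point b \<mu> \<nu>) * jacobi_cs \<tau> (2 * ell_K \<tau> * div_point b \<mu> \<nu>)
       = cs_scale\<^sup>2 * (even_sign \<mu> * g theta2 (of_int a * div_point b \<mu> \<nu>) * g theta2 (div_point b \<mu> \<nu>))"
      unfolding sgn[OF \<open>\<mu> \<ge> 0\<close>] mult.assoc[of "2 * ell_K \<tau>" "of_int a"] jacobi_cs_g
      by (simp only: power2_eq_square mult_ac)
  qed
  also have "\<dots> = cs_scale\<^sup>2 * psum a b"
    by (simp add: psum_def sum_distrib_left case_prod_unfold)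
  finally show ?thesis .
qed

text \<open>\<open>g theta2 (c * z)\<close> is \<open>1 / c\<close> times an expansion whose
  coefficient is multiplied by \<open>c\<^sup>2\<close>; this produces
  \<open>1 + a\<^sup>2 + b\<^sup>2\<close>. The subtracted product cancels the cubic pole, and by
  \<open>k0\<close> it leaves the residue unchanged.\<close>

lemma simple_pole_part_origin:
  assumes ab: "a \<noteq> 0" "b \<noteq> 0"
    and k2: "k2 analytic_on {0}" "\<forall>\<^sub>F z in at 0. g theta2 z = 1 / z + z * k2 z"
    and k3: "k3 analytic_on {0}" "\<forall>\<^sub>F z in at 0. g theta3 z = 1 / z + z * k3 z"
    and k4: "k4 analytic_on {0}" "\<forall>\<^sub>F z in at 0. g theta4 z = 1 / z + z * k4 z"
    and k0: "k2 0 + k3 0 + k4 0 = 0"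
  shows "simple_pole_part (\<lambda>z. g theta2 z * g theta2 (a * z) * g theta2 (b * z)
       - 1 / (a * b) * (g theta2 z * g theta3 z * g theta4 z)) 0 (k2 0 * (1 + a\<^sup>2 + b\<^sup>2) / (a * b))"
proof -
  define ka where "ka = (\<lambda>z. a\<^sup>2 * k2 (a * z))"
  define kb where "kb = (\<lambda>z. b\<^sup>2 * k2 (b * z))"
  have an: "ka analytic_on {0}" "kb analytic_on {0}"
    unfolding ka_def kb_def by (intro analytic_intros analytic_at_scale; simp add: k2)+
  have scale: "\<forall>\<^sub>F z in at 0. g theta2 (c * z) = 1 / c * (1 / z + z * (c\<^sup>2 * k2 (c * z)))" if "c \<noteq> 0" for c
  proof -
    have "filterlim (\<lambda>z. c * z) (at 0) (at 0)"
      unfolding filterlim_at using that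
      by (auto intro!: tendsto_eq_intros simp: eventually_at_filter)
    from eventually_compose_filterlim[OF k2(2) this] show ?thesis
      using that by (auto elim!: eventually_mono simp: power2_eq_square field_simps)
  qed
  define m where "m = (\<lambda>z. 1 / (a * b) *
     ((k2 z + ka z + kb z - (k2 z + k3 z + k4 z))
      + z\<^sup>2 * ((k2 z * ka z + k2 z * kb z + ka z * kb z) - (k2 z * k3 z + k2 z * k4 z + k3 z * k4 z))
      + z ^ 4 * (k2 z * ka z * kb z - k2 z * k3 z * k4 z)))"
  have cubic: "(1 / z + z * x) * (1 / z + z * y) * (1 / z + z * w)
      = 1 / z ^ 3 + 1 / z * ((x + y + w) + z\<^sup>2 * (x * y + x * w + y * w) + z ^ 4 * (x * y * w))"
    if "z \<noteq> 0" for x y z w :: complex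
    using that by (simp add: field_simps power2_eq_square power3_eq_cube power4_eq_xxxx)
  have m: "m analytic_on {0}" unfolding m_def by (intro analytic_intros an k2 k3 k4)
  have "simple_pole_part (\<lambda>z. 1 / (z - 0) * m z) 0 (1 * m 0)"
    by (rule simple_pole_part_mult_analytic[OF _ m]) (rule simple_pole_partI[of "\<lambda>_. 0"], auto)
  moreover have "m 0 = k2 0 * (1 + a\<^sup>2 + b\<^sup>2) / (a * b)"
  proof -
    have "m 0 = 1 / (a * b) * (k2 0 + a\<^sup>2 * k2 0 + b\<^sup>2 * k2 0 - (k2 0 + k3 0 + k4 0))"
      by (simp add: m_def ka_def kb_def)
    thus ?thesis unfolding k0 by (simp add: algebra_simps add_divide_distrib)
  qed
  moreover have "\<forall>\<^sub>F z in at 0. g theta2 z * g theta2 (a * z) * g theta2 (b * z)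
       - 1 / (a * b) * (g theta2 z * g theta3 z * g theta4 z) = 1 / (z - 0) * m z"
  proof -
    have "\<forall>\<^sub>F z::complex in at 0. z \<noteq> 0" by (simp add: eventually_at_filter)
    with k2(2) k3(2) k4(2) scale[OF ab(1)] scale[OF ab(2)] show ?thesis
    proof eventually_elim
      case (elim z)
      have "g theta2 z * g theta2 (a * z) * g theta2 (b * z) - 1 / (a * b) * (g theta2 z * g theta3 z * g theta4 z)
         = 1 / (a * b) * ((1 / z + z * k2 z) * (1 / z + z * ka z) * (1 / z + z * kb z)
            - (1 / z + z * k2 z) * (1 / z + z * k3 z) * (1 / z + z * k4 z))"
        unfolding elim(1-5) ka_def kb_def by (simp add: right_diff_distrib)
      also have "\<dots> = 1 / (z - 0) * m z"
        unfolding cubic[OF elim(6)] m_def using elim(6) by (simp add: algebra_simps)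
      finally show ?case .
    qed
  qed
  ultimately show ?thesis by (auto intro: simple_pole_part_cong)
qed

lemma reciprocity:
  assumes ab: "a > 0" "b > 0" "coprime a b" "odd (a + b)"
  shows "4 * of_int a * of_int b * (ell_dedekind_sum \<tau> a b + ell_dedekind_sum \<tau> b a)
     = of_int (1 + a\<^sup>2 + b\<^sup>2) * (1/3 - 1/6 * mod_lambda \<tau>)"
proof -
  obtain k2 k3 k4 where
    k2: "k2 analytic_on {0}" "\<forall>\<^sub>F z in at 0. g theta2 z = 1 / z + z * k2 z" and
    k3: "k3 analytic_on {0}" "\<forall>\<^sub>F z in at 0. g theta3 z = 1 / z + z * k3 z" and
    k4: "k4 analytic_on {0}" "\<forall>\<^sub>F z in at 0. g theta4 z = 1 / z + z * k4 z" and
    k0: "k2 0 + k3 0 + k4 0 = 0" and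
    sc: "cs_scale\<^sup>2 * k2 0 = - (1/3 - 1/6 * mod_lambda \<tau>)" and
    "theta3 0 \<tau> ^ 4 = theta2 0 \<tau> ^ 4 + theta4 0 \<tau> ^ 4"
    by (rule expansions)
  note g2_an = g_analytic[where \<theta> = theta2, OF theta_holomorphic(2) theta_null_nonzero(1)]
  note g3_an = g_analytic[where \<theta> = theta3, OF theta_holomorphic(3) theta_null_nonzero(2)]
  note g4_an = g_analytic[where \<theta> = theta4, OF theta_holomorphic(4) theta_null_nonzero(3)]
  define D where "D = (\<lambda>z. 1 / (of_int a * of_int b) * (g theta2 z * g theta3 z * g theta4 z))"
  define F where "F = (\<lambda>z. g theta2 z * g theta2 (of_int a * z) * g theta2 (of_int b * z) - D z)"
  define R where "R = k2 0 * (1 + (of_int a)\<^sup>2 + (of_int b)\<^sup>2) / (of_int a * of_int b)"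
  \<comment> \<open>For \<open>n\<close> one of \<open>a\<close> and \<open>b\<close>, the number
    \<open>a + b - n\<close> is the other one.\<close>
  define t where "t = (\<lambda>n \<mu> \<nu>. even_sign \<mu> / of_int n * (g theta2 (of_int (a + b - n) * div_point n \<mu> \<nu>) * g theta2 (div_point n \<mu> \<nu>)))"
  \<comment> \<open>Tagging a pole with its denominator makes the index sets for \<open>a\<close>
    and \<open>b\<close> disjoint. The origin belongs to neither grid and enters once, as
    \<open>(1, 0, 0)\<close>.\<close>
  define I where "I = insert (1, 0, 0) (Pair a ` grid a \<union> Pair b ` grid b)"
  define pt where "pt = (\<lambda>(n, \<mu>, \<nu>). div_point n \<mu> \<nu>)"
  define res where "res = (\<lambda>(n, \<mu>, \<nu>). if (\<mu>, \<nu>) = (0, 0) then R else t n \<mu> \<nu>)"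
  have "a \<noteq> b" using ab by auto
  have D_an: "D analytic_on {c}" if "c \<notin> lattice \<tau>" for c
    unfolding D_def by (intro analytic_intros g2_an g3_an g4_an that)
  have other: "simple_pole_part F c 0"
    if c: "c \<notin> lattice \<tau>" "of_int a * c \<notin> lattice \<tau>" "of_int b * c \<notin> lattice \<tau>" for c
  proof -
    have "F analytic_on {c}" unfolding F_def
      by (intro analytic_intros analytic_at_scale g2_an D_an c)
    thus ?thesis by (rule simple_pole_part_analytic)
  qed
  have pole: "simple_pole_part F (div_point n \<mu> \<nu>) (t n \<mu> \<nu>)"
    if n: "n \<in> {a, b}" "(\<mu>, \<nu>) \<in> grid n" for n \<mu> \<nu>
  proof -
    define n' where "n' = a + b - n"
    have n': "coprime n n'" "n > 0" "F = (\<lambda>z. g theta2 (of_int n * z) * (g theta2 (of_int n' * z) * g theta2 z) - D z)"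
      using n(1) ab by (auto simp: n'_def F_def coprime_commute mult_ac fun_eq_iff)
    let ?w = "div_point n \<mu> \<nu>"
    have w: "?w \<notin> lattice \<tau>" by (rule grid_not_lattice[OF n'(2) n(2)])
    have "of_int n * ?w \<in> lattice \<tau>" using n'(2) by (simp add: lattice_closed)
    hence w': "of_int n' * ?w \<notin> lattice \<tau>" using coprime_lattice[OF n'(1)] w by blast
    have "simple_pole_part (\<lambda>z. g theta2 (of_int n * z) * (g theta2 (of_int n' * z) * g theta2 z)) ?w
      (even_sign \<mu> / of_int n * (g theta2 (of_int n' * ?w) * g theta2 ?w))"
      by (intro simple_pole_part_mult_analytic simple_pole_part_g2_scaled n'
          analytic_intros analytic_at_scale g2_an w w')
    hence "simple_pole_part F ?w (even_sign \<mu> / of_int n * (g theta2 (of_int n' * ?w) * g theta2 ?w) - 0)"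
      unfolding n'(3) by (intro simple_pole_part_diff simple_pole_part_analytic D_an w)
    thus ?thesis by (simp add: t_def n'_def)
  qed
  have "(\<Sum>i\<in>I. res i) = 0"
  proof (rule sum_residues_elliptic)
    show "F (z + 1) = F z" for z
      using g2_lattice_mult[of a z 0 1] g2_lattice_mult[of b z 0 1]
      by (simp add: F_def D_def g_add_1 even_sign_def)
    show "F (z + \<tau>) = F z" for z
      using g2_lattice_mult[of a z 1 0] g2_lattice_mult[of b z 1 0] ab(4)
      by (auto simp: F_def D_def g_add_tau even_sign_def)
    show "finite I" by (simp add: I_def finite_grid)
    show "simple_pole_part F (pt i) (res i)" if i: "i \<in> I" for i
    proof (cases "i = (1, 0, 0)")
      case True
      have "simple_pole_part F 0 R" unfolding F_def D_def R_def
        by (rule simple_pole_part_origin[OF _ _ k2 k3 k4 k0]) (use ab in auto)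
      thus ?thesis by (simp add: True pt_def res_def)
    next
      case False
      then obtain n \<mu> \<nu> where i': "i = (n, \<mu>, \<nu>)" "n \<in> {a, b}" "(\<mu>, \<nu>) \<in> grid n"
        using i by (auto simp: I_def)
      moreover from this have "(\<mu>, \<nu>) \<noteq> (0, 0)" by (auto simp: grid_def)
      ultimately show ?thesis using pole by (simp only: pt_def res_def split) simp
    qed
    show "simple_pole_part F c 0" if c: "\<And>i. i \<in> I \<Longrightarrow> c - pt i \<notin> lattice \<tau>" for c
    proof (rule other)
      show c0: "c \<notin> lattice \<tau>" using c[of "(1, 0, 0)"] by (simp add: I_def pt_def)
      have "of_int n * c \<notin> lattice \<tau>" if n: "n \<in> {a, b}" for n
      proof
        have "n > 0" using n ab by auto
        assume "of_int n * c \<in> lattice \<tau>"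
        then obtain k l where kl: "of_int n * c = of_int k * \<tau> + of_int l" by (auto simp: lattice_def)
        have "c = (of_int n * c) / of_int n" using \<open>n > 0\<close> by simp
        \<comment> \<open>Division with remainder in the lattice coordinates of \<open>n * c\<close>
          writes \<open>c\<close> as a grid point, or 0, plus a lattice element.\<close>
        also have "\<dots> = div_point n (k mod n) (l mod n) + (of_int (k div n) * \<tau> + of_int (l div n))"
        proof -
          have "(of_int x :: complex) = of_int (x div n) * of_int n + of_int (x mod n)" for x
            by (metis div_mult_mod_eq of_int_add of_int_mult)
          from this[of k] this[of l] show ?thesis unfolding kl using \<open>n > 0\<close> by (simp add: field_simps)
        qed
        finally have cw: "c - div_point n (k mod n) (l mod n) \<in> lattice \<tau>" by (simp add: lattice_closed)
        show False
        proof (cases "(k mod n, l mod n) \<in> grid n")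
          case True
          hence "(n, k mod n, l mod n) \<in> I" using n by (auto simp: I_def)
          from c[OF this] cw show False by (simp add: pt_def)
        next
          case False
          hence "k mod n = 0" "l mod n = 0" using \<open>n > 0\<close> by (auto simp: grid_def)
          with cw c0 show False by simp
        qed
      qed
      thus "of_int a * c \<notin> lattice \<tau>" "of_int b * c \<notin> lattice \<tau>" by auto
    qed
    show "i = j" if "i \<in> I" "j \<in> I" "pt i - pt j \<in> lattice \<tau>" for i j
    proof -
      have nI: "pt i \<notin> lattice \<tau> \<and> (\<exists>n \<mu> \<nu>. i = (n, \<mu>, \<nu>) \<and> n \<in> {a, b} \<and> (\<mu>, \<nu>) \<in> grid n \<and> of_int n * pt i \<in> lattice \<tau>)"
        if i: "i \<in> I" "i \<noteq> (1, 0, 0)" for i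
      proof -
        obtain n \<mu> \<nu> where i': "i = (n, \<mu>, \<nu>)" "n \<in> {a, b}" "(\<mu>, \<nu>) \<in> grid n"
          using i by (auto simp: I_def)
        have "n > 0" using i' ab by auto
        show ?thesis using grid_not_lattice[OF \<open>n > 0\<close> i'(3)] i' \<open>n > 0\<close> by (auto simp: pt_def lattice_closed)
      qed
      have j': "pt j \<in> lattice \<tau>" if "pt i \<in> lattice \<tau>" using lattice_closed(6)[OF that \<open>pt i - pt j \<in> _\<close>] by simp
      have i': "pt i \<in> lattice \<tau>" if "pt j \<in> lattice \<tau>" using lattice_closed(5)[OF that \<open>pt i - pt j \<in> _\<close>] by simp
      have pt0: "pt (1, 0, 0) \<in> lattice \<tau>" by (simp add: pt_def lattice_closed)
      show ?thesis
      proof (cases "i = (1, 0, 0) \<or> j = (1, 0, 0)")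
        case True
        then show ?thesis using pt0 nI that i' j' by metis
      next
        case False
        from nI[OF that(1)] False obtain n \<mu> \<nu> where i: "i = (n, \<mu>, \<nu>)" "n \<in> {a, b}" "(\<mu>, \<nu>) \<in> grid n"
          "of_int n * pt i \<in> lattice \<tau>" "pt i \<notin> lattice \<tau>" by blast
        from nI[OF that(2)] False obtain n' \<mu>' \<nu>' where j: "j = (n', \<mu>', \<nu>')" "n' \<in> {a, b}" "(\<mu>', \<nu>') \<in> grid n'"
          "of_int n' * pt j \<in> lattice \<tau>" by blast
        \<comment> \<open>If \<open>n\<close> and \<open>n'\<close> were coprime, having both
          multiples of \<open>pt i\<close> in the lattice would put \<open>pt i\<close> itself
          there.\<close>
        have "n = n'"
        proof (rule ccontr)
          assume "n \<noteq> n'"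
          hence "coprime n n'" using i(2) j(2) ab(3) by (auto simp: coprime_commute)
          moreover have "of_int n' * pt i \<in> lattice \<tau>"
            using lattice_closed(5)[OF j(4) of_int_mult_lattice[OF that(3), of n']] by (simp add: algebra_simps)
          ultimately show False using coprime_lattice i(4,5) by blast
        qed
        moreover have "n > 0" using i(2) ab by auto
        ultimately show ?thesis using grid_eq_of_lattice[of n \<mu> \<nu> \<mu>' \<nu>'] i j that(3) by (auto simp: pt_def)
      qed
    qed
  qed
  also have "(\<Sum>i\<in>I. res i) = R + ((\<Sum>i\<in>Pair a ` grid a. res i) + (\<Sum>i\<in>Pair b ` grid b. res i))"
  proof -
    have "(1, 0, 0) \<notin> Pair a ` grid a \<union> Pair b ` grid b" by (auto simp: grid_def)
    moreover have "Pair a ` grid a \<inter> Pair b ` grid b = {}" using \<open>a \<noteq> b\<close> by auto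
    ultimately show ?thesis unfolding I_def
      by (simp add: finite_grid sum.union_disjoint res_def[THEN fun_cong, of "(1, 0, 0)"] del: Un_iff)
  qed
  also have sum_n: "(\<Sum>i\<in>Pair n ` grid n. res i) = psum (a + b - n) n / of_int n" for n
  proof -
    have "(\<Sum>i\<in>Pair n ` grid n. res i) = (\<Sum>(\<mu>, \<nu>)\<in>grid n. t n \<mu> \<nu>)"
      by (subst sum.reindex) (auto simp: inj_on_def res_def grid_def intro!: sum.cong split: if_splits)
    thus ?thesis by (simp add: t_def psum_def sum_divide_distrib case_prod_unfold mult.assoc)
  qed
  finally have "R + (psum b a / of_int a + psum a b / of_int b) = 0" by (simp add: sum_n)
  hence "of_int a * of_int b * (R + (psum b a / of_int a + psum a b / of_int b)) = 0" by simp
  moreover have "of_int a * of_int b * R = k2 0 * of_int (1 + a\<^sup>2 + b\<^sup>2)" using ab by (simp add: R_def)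
  ultimately have "k2 0 * of_int (1 + a\<^sup>2 + b\<^sup>2) + (of_int b * psum b a + of_int a * psum a b) = 0"
    using ab by (simp add: distrib_left)
  hence "cs_scale\<^sup>2 * (k2 0 * of_int (1 + a\<^sup>2 + b\<^sup>2) + (of_int b * psum b a + of_int a * psum a b)) = 0" by simp
  hence "of_int (1 + a\<^sup>2 + b\<^sup>2) * (cs_scale\<^sup>2 * k2 0) + of_int b * (cs_scale\<^sup>2 * psum b a) + of_int a * (cs_scale\<^sup>2 * psum a b) = 0"
    by (simp only: distrib_left mult_ac add_ac)
  thus ?thesis unfolding sc ell_dedekind_sum_psum[OF ab(1), symmetric] ell_dedekind_sum_psum[OF ab(2), symmetric]
    by (simp add: algebra_simps)
qed

section \<open>Symmetries and vanishing of the sum over division points\<close>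

lemma psum_minus: "psum (- a) b = - psum a b"
  by (simp add: psum_def g2_minus case_prod_unfold sum_negf)

text \<open>The argument moves by a lattice element with even coefficient of \<tau>, so no sign
  arises. A shift of \<open>a\<close> by \<open>b\<close> alone would multiply each summand by the
  sign of \<open>\<mu>\<close>.\<close>

lemma psum_add_even:
  assumes "b > 0" shows "psum (a + 2 * k * b) b = psum a b"
  unfolding psum_def
proof (intro sum.cong refl, clarify)
  fix \<mu> \<nu>
  have "of_int (a + 2 * k * b) * div_point b \<mu> \<nu> = of_int a * div_point b \<mu> \<nu> + (of_int (2 * k * \<mu>) * \<tau> + of_int (2 * k * \<nu>))"
    using assms by (simp add: field_simps)
  hence "g theta2 (of_int (a + 2 * k * b) * div_point b \<mu> \<nu>) = g theta2 (of_int a * div_point b \<mu> \<nu>)"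
    by (simp only: g2_lattice) (simp add: even_sign_def)
  thus "even_sign \<mu> * g theta2 (of_int (a + 2 * k * b) * div_point b \<mu> \<nu>) * g theta2 (div_point b \<mu> \<nu>)
      = even_sign \<mu> * g theta2 (of_int a * div_point b \<mu> \<nu>) * g theta2 (div_point b \<mu> \<nu>)" by simp
qed

text \<open>For a division point \<open>w\<close>, \<open>a * (a * w) = m * (b * w) - w\<close>,
  where \<open>b * w\<close> is in the lattice. As \<open>a\<close> is even, the sign of the index
  \<open>a * \<mu>\<close> is 1; as \<open>m\<close> is odd, the lattice shift restores the sign of
  \<open>\<mu>\<close>. Oddness of cs leaves the factor -1.\<close>

lemma psum_eq_0:
  assumes b: "b > 0" "odd b" "even a" and m: "a\<^sup>2 + 1 = m * b"
  shows "psum a b = 0"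
proof -
  define h where "h = (\<lambda>(\<mu>, \<nu>). even_sign \<mu> * g theta2 (of_int a * div_point b \<mu> \<nu>) * g theta2 (div_point b \<mu> \<nu>))"
  define S where "S = (\<lambda>(\<mu>, \<nu>). (a * \<mu> mod b, a * \<nu> mod b))"
  \<comment> \<open>Changing \<open>\<mu>\<close> by \<open>u * b\<close> with \<open>b\<close> odd
    alters the index sign by the sign of \<open>u\<close>. The factor at \<open>w\<close> alters by
    the same sign, and the factor at \<open>a * w\<close> stays fixed because \<open>a\<close> is
    even.\<close>
  have per: "h (\<mu> mod b, \<nu> mod b) = h (\<mu>, \<nu>)" for \<mu> \<nu>
  proof -
    define u where "u = \<mu> div b"
    define v where "v = \<nu> div b"
    have x: "(of_int x :: complex) = of_int (x mod b) + of_int (x div b) * of_int b" for x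
      by (metis add.commute div_mult_mod_eq of_int_add of_int_mult)
    have d: "div_point b \<mu> \<nu> = div_point b (\<mu> mod b) (\<nu> mod b) + (of_int u * \<tau> + of_int v)"
      unfolding u_def v_def using b(1) by (subst x[of \<mu>], subst x[of \<nu>]) (simp add: field_simps)
    have "even_sign \<mu> = even_sign (\<mu> mod b) * even_sign u"
    proof -
      have "\<mu> = u * b + \<mu> mod b" by (simp add: u_def)
      hence "even \<mu> \<longleftrightarrow> even (u * b + \<mu> mod b)" by simp
      hence "even \<mu> \<longleftrightarrow> (even u \<longleftrightarrow> even (\<mu> mod b))" using b(2) by simp
      thus ?thesis by (auto simp: even_sign_def)
    qed
    moreover have "even_sign (a * u) = 1" using b(3) by (simp add: even_sign_def)
    ultimately show ?thesis unfolding h_def d split g2_lattice_mult g2_lattice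
      by (cases "even u") (simp_all add: even_sign_def[of u])
  qed
  have "odd m" using m b(3) by (metis even_mult_iff even_plus_one_iff power2_eq_square)
  have neg: "h (a * \<mu>, a * \<nu>) = - h (\<mu>, \<nu>)" for \<mu> \<nu>
  proof -
    have am: "(of_int a :: complex)\<^sup>2 + 1 = of_int m * of_int b"
      using m by (metis of_int_1 of_int_add of_int_mult of_int_power)
    have "of_int a * div_point b (a * \<mu>) (a * \<nu>) = ((of_int a)\<^sup>2 + 1) * div_point b \<mu> \<nu> - div_point b \<mu> \<nu>"
      by (simp add: power2_eq_square algebra_simps add_divide_distrib)
    also have "\<dots> = - div_point b \<mu> \<nu> + (of_int (m * \<mu>) * \<tau> + of_int (m * \<nu>))"
      unfolding am using b(1) by (simp add: field_simps)
    finally have 1: "g theta2 (of_int a * div_point b (a * \<mu>) (a * \<nu>)) = - even_sign (m * \<mu>) * g theta2 (div_point b \<mu> \<nu>)"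
      by (simp only: g2_lattice g2_minus) simp
    have 2: "div_point b (a * \<mu>) (a * \<nu>) = of_int a * div_point b \<mu> \<nu>" by (simp add: algebra_simps add_divide_distrib)
    have 3: "even_sign (m * \<mu>) = even_sign \<mu>" "even_sign (a * \<mu>) = 1"
      using \<open>odd m\<close> b(3) by (simp_all add: even_sign_def)
    show ?thesis unfolding h_def split 1 unfolding 2 3 by simp
  qed
  have cop: "coprime a b"
  proof (rule coprimeI)
    fix c assume "c dvd a" "c dvd b"
    hence "c dvd m * b - a\<^sup>2" by (simp add: power2_eq_square)
    moreover have "m * b - a\<^sup>2 = 1" using m by simp
    ultimately show "is_unit c" by simp
  qed
  have z: "b dvd x" if "b dvd a * x" for x
    using that cop by (metis coprime_commute coprime_dvd_mult_right_iff)
  have inj: "inj_on S (grid b)"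
  proof (rule inj_onI, clarify)
    fix \<mu> \<nu> \<mu>' \<nu>' assume g: "(\<mu>, \<nu>) \<in> grid b" "(\<mu>', \<nu>') \<in> grid b" and eq: "S (\<mu>, \<nu>) = S (\<mu>', \<nu>')"
    have *: "x = y" if "a * x mod b = a * y mod b" "0 \<le> x" "x < b" "0 \<le> y" "y < b" for x y
    proof -
      have "b dvd a * (x - y)" using that(1) by (simp add: mod_eq_dvd_iff right_diff_distrib)
      hence "b dvd x - y" by (rule z)
      hence "x mod b = y mod b" by (simp add: mod_eq_dvd_iff)
      thus ?thesis using that by simp
    qed
    show "\<mu> = \<mu>' \<and> \<nu> = \<nu>'" using g eq by (auto simp: S_def grid_def intro!: *)
  qed
  have "S ` grid b \<subseteq> grid b"
  proof (rule image_subsetI)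
    fix y assume "y \<in> grid b"
    then obtain \<mu> \<nu> where y: "y = (\<mu>, \<nu>)" and g: "(\<mu>, \<nu>) \<in> grid b" by (metis surj_pair)
    have *: "x = 0" if "a * x mod b = 0" "0 \<le> x" "x < b" for x
    proof -
      have "b dvd x" by (rule z, rule mod_0_imp_dvd) (rule that(1))
      thus ?thesis using that(2,3) by (metis dvd_imp_mod_0 mod_pos_pos_trivial)
    qed
    have "\<not> (a * \<mu> mod b = 0 \<and> a * \<nu> mod b = 0)"
    proof
      assume "a * \<mu> mod b = 0 \<and> a * \<nu> mod b = 0"
      moreover have "0 \<le> \<mu>" "\<mu> < b" "0 \<le> \<nu>" "\<nu> < b" using g by (auto simp: grid_def)
      ultimately have "\<mu> = 0" "\<nu> = 0" using *[of \<mu>] *[of \<nu>] by (iprover, iprover)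
      with g show False by (simp add: grid_def)
    qed
    thus "S y \<in> grid b" using b(1) by (simp add: y S_def grid_def)
  qed
  hence "S ` grid b = grid b" using endo_inj_surj[OF finite_grid] inj by blast
  hence "psum a b = (\<Sum>x\<in>S ` grid b. h x)" by (simp add: psum_def h_def)
  also have "\<dots> = (\<Sum>x\<in>grid b. h (S x))" by (simp add: sum.reindex[OF inj])
  also have "\<dots> = (\<Sum>x\<in>grid b. - h x)" by (intro sum.cong refl) (auto simp: S_def per neg)
  also have "\<dots> = - psum a b" by (simp add: psum_def h_def sum_negf)
  finally show ?thesis by simp
qed

end

section \<open>Integrality\<close>

lemma upper_half_point_iff: "upper_half_point \<tau> \<longleftrightarrow> \<tau> \<in> upper_half_plane"
  by (simp add: upper_half_point_def upper_half_plane_def)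

lemma ell_dedekind_sum_minus_shift:
  assumes "\<tau> \<in> upper_half_plane" "b > 0"
  shows "ell_dedekind_sum \<tau> (- a) b = - ell_dedekind_sum \<tau> a b"
    and "ell_dedekind_sum \<tau> (a + 2 * k * b) b = ell_dedekind_sum \<tau> a b"
proof -
  interpret upper_half_point \<tau> using assms by (simp add: upper_half_point_iff)
  have eq: "ell_dedekind_sum \<tau> c b = cs_scale\<^sup>2 * psum c b / (4 * of_int b)" for c
    using ell_dedekind_sum_psum[OF assms(2), of c] assms(2) by (simp add: field_simps)
  show "ell_dedekind_sum \<tau> (- a) b = - ell_dedekind_sum \<tau> a b" by (simp add: eq psum_minus)
  show "ell_dedekind_sum \<tau> (a + 2 * k * b) b = ell_dedekind_sum \<tau> a b" by (simp add: eq psum_add_even assms)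
qed

text \<open>\<open>N\<close> stands for \<open>4 * b * Q a b\<close>, described without
  \<open>Q\<close> so that existence of the rational number comes out as a result. The congruence is
  included to strengthen the induction.\<close>

definition is_numerator :: "int \<Rightarrow> int \<Rightarrow> int \<Rightarrow> bool" where
  "is_numerator a b N \<longleftrightarrow> [a * N = a\<^sup>2 + 1] (mod b) \<and>
     (\<forall>\<tau>\<in>upper_half_plane. 4 * of_int b * ell_dedekind_sum \<tau> a b = of_int N * (1/3 - 1/6 * mod_lambda \<tau>))"

lemma is_numerator_minus:
  assumes "b > 0" "is_numerator a b N"
  shows "is_numerator (- a) b (- N)"
  using assms ell_dedekind_sum_minus_shift(1)[OF _ assms(1)] by (auto simp: is_numerator_def)

lemma is_numerator_add_even:
  assumes "b > 0" "is_numerator a b N"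
  shows "is_numerator (a + 2 * k * b) b N"
proof -
  have "[(a + 2 * k * b) * N = a * N] (mod b)"
    by (simp add: cong_iff_dvd_diff algebra_simps)
  moreover have "[(a + 2 * k * b)\<^sup>2 + 1 = a\<^sup>2 + 1] (mod b)"
    by (simp add: cong_iff_dvd_diff power2_eq_square algebra_simps)
  ultimately show ?thesis using assms ell_dedekind_sum_minus_shift(2)[OF _ assms(1)]
    by (auto simp: is_numerator_def intro: cong_trans cong_sym)
qed

text \<open>The congruence in \<^const>\<open>is_numerator\<close> is exactly what makes the division by \<open>a\<close> in the
  reciprocity law exact.\<close>

lemma is_numerator_swap:
  assumes ab: "a > 0" "b > 0" "coprime a b" "odd (a + b)" and N: "is_numerator b a N"
  shows "\<exists>M. is_numerator a b M"
proof -
  have "a dvd b * N - (b\<^sup>2 + 1)" using N by (simp add: is_numerator_def cong_iff_dvd_diff)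
  hence "a dvd a * a - (b * N - (b\<^sup>2 + 1))" by (rule dvd_diff[OF dvd_triv_left])
  then obtain M where M: "a * a - (b * N - (b\<^sup>2 + 1)) = a * M" by (auto simp: dvd_def)
  \<comment> \<open>\<open>a * M\<close> is \<open>1 + a\<^sup>2 + b\<^sup>2 - b * N\<close>, the
    value that reciprocity dictates; reading it modulo \<open>b\<close> gives the new congruence, so
    the invariant reproduces itself.\<close>
  have "a * M - (a\<^sup>2 + 1) = b * (b - N)" using M by (simp add: power2_eq_square algebra_simps)
  hence "[a * M = a\<^sup>2 + 1] (mod b)" by (simp add: cong_iff_dvd_diff)
  moreover have "4 * of_int b * ell_dedekind_sum \<tau> a b = of_int M * (1/3 - 1/6 * mod_lambda \<tau>)"
    if tau: "\<tau> \<in> upper_half_plane" for \<tau>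
  proof -
    interpret upper_half_point \<tau> using tau by (simp add: upper_half_point_iff)
    define c where "c = 1/3 - 1/6 * mod_lambda \<tau>"
    have N': "4 * of_int a * ell_dedekind_sum \<tau> b a = of_int N * c"
      using N tau by (simp add: is_numerator_def c_def)
    have "of_int a * (4 * of_int b * ell_dedekind_sum \<tau> a b)
      = 4 * of_int a * of_int b * (ell_dedekind_sum \<tau> a b + ell_dedekind_sum \<tau> b a)
        - of_int b * (4 * of_int a * ell_dedekind_sum \<tau> b a)" by (simp add: algebra_simps)
    also have "\<dots> = of_int (1 + a\<^sup>2 + b\<^sup>2) * c - of_int b * (of_int N * c)"
      unfolding N' reciprocity[OF ab] c_def ..
    also have "\<dots> = of_int (1 + a\<^sup>2 + b\<^sup>2 - b * N) * c" by (simp add: algebra_simps)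
    also have "1 + a\<^sup>2 + b\<^sup>2 - b * N = a * M" using M by (simp add: power2_eq_square algebra_simps)
    finally show ?thesis using ab by (simp add: c_def mult.assoc)
  qed
  ultimately show ?thesis by (auto simp: is_numerator_def)
qed

text \<open>Only shifts by multiples of \<open>2 * b\<close> are available, so representatives lie
  in \<open>[- b, b)\<close>. Parity excludes \<open>- b\<close>, and coprimality excludes 0 when
  \<open>b > 1\<close>. After a possible change of sign, swapping leads to the strictly smaller
  second entry \<open>s\<close>.\<close>

lemma exists_numerator: "b > 0 \<Longrightarrow> coprime a b \<Longrightarrow> odd (a + b) \<Longrightarrow> \<exists>N. is_numerator a b N"
proof (induction "nat b" arbitrary: a b rule: less_induct)
  case less
  show ?case
  proof (cases "b = 1")
    case True
    have "ell_dedekind_sum \<tau> a 1 = 0" for \<tau> by (simp add: ell_dedekind_sum_def)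
    hence "is_numerator a 1 0" by (simp add: is_numerator_def)
    thus ?thesis using True by blast
  next
    case False
    \<comment> \<open>Adding \<open>b\<close> before dividing centres the remainder around
      0.\<close>
    define k where "k = (a + b) div (2 * b)"
    define a' where "a' = a - 2 * k * b"
    have "a' = (a + b) mod (2 * b) - b" by (simp add: a'_def k_def minus_mult_div_eq_mod[symmetric] algebra_simps)
    moreover have "0 \<le> (a + b) mod (2 * b)" "(a + b) mod (2 * b) < 2 * b" using less.prems by auto
    ultimately have bd: "- b \<le> a'" "a' < b" by auto
    have par: "odd (a' + b)" using less.prems(3) by (simp add: a'_def)
    have "gcd a' b = gcd a b"
      using gcd_add_mult[of b "- 2 * k" a] by (simp add: a'_def gcd.commute algebra_simps)
    hence cop: "coprime a' b" using less.prems(2) by (simp add: coprime_iff_gcd_eq_1)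
    have "a' \<noteq> 0" using cop False less.prems(1) by auto
    have "a' \<noteq> - b" using par by auto
    define s where "s = \<bar>a'\<bar>"
    have s: "s > 0" "s < b" "coprime s b" "odd (s + b)"
      using bd cop par \<open>a' \<noteq> 0\<close> \<open>a' \<noteq> - b\<close> by (auto simp: s_def abs_if)
    have "\<exists>N. is_numerator b s N"
      using s by (intro less.hyps) (auto simp: coprime_commute add.commute)
    then obtain N where "is_numerator s b N" using is_numerator_swap[OF s(1) less.prems(1) s(3,4)] by blast
    hence "\<exists>N. is_numerator a' b N"
      using is_numerator_minus[OF less.prems(1)] by (cases "a' > 0") (fastforce simp: s_def)+
    then obtain N where "is_numerator a' b N" ..
    from is_numerator_add_even[OF less.prems(1) this, of k] show ?thesis by (auto simp: a'_def)
  qed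
qed

text \<open>At \<open>\<tau> = \<i>\<close> the nome is real, hence so are theta3 and theta4 at 0.
  The quartic identity gives \<open>\<lambda> = 1 - t\<close> with \<open>t\<close> the fourth power
  of a real number, and the factor equals \<open>(1 + t) / 6\<close>. One such \<tau> makes the
  rational number defining \<open>Q\<close> unique.\<close>

lemma exists_nonzero_factor: "\<exists>\<tau>\<in>upper_half_plane. 1/3 - 1/6 * mod_lambda \<tau> \<noteq> 0"
proof
  show i: "\<i> \<in> upper_half_plane" by (simp add: upper_half_plane_def)
  interpret upper_half_point \<i> using i by (simp add: upper_half_point_iff)
  have real: "Im (theta_half p (of_real y)) = 0" for y
  proof -
    have "\<i> * of_real pi * \<i> = of_real (- pi)" by (simp add: mult_ac)
    hence "p = of_real (exp (- pi))" unfolding p_def by (simp only: exp_of_real)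
    hence "p ^ n\<^sup>2 * of_real y ^ n = of_real (exp (- pi) ^ n\<^sup>2 * y ^ n)" for n by simp
    hence "Im (p ^ n\<^sup>2 * of_real y ^ n) = 0" for n by (metis Im_complex_of_real)
    moreover have "(\<lambda>n. Im (p ^ n\<^sup>2 * of_real y ^ n)) sums Im (theta_half p (of_real y))"
      by (intro sums_Im theta_half_sums)
    ultimately have "(\<lambda>n. 0) sums Im (theta_half p (of_real y))" by (simp only:)
    thus ?thesis using sums_unique2 sums_zero by blast
  qed
  have X: "X 0 = of_real 1" "X (0 + 1 / 2) = of_real (- 1)" unfolding X_shift by (simp_all add: XY_simps)
  have "Im (theta3 0 \<i>) = 0" "Im (theta4 0 \<i>) = 0"
    unfolding theta3_J theta4_J J_def X using real[of 1] real[of "-1"] by simp_all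
  then obtain x y :: real where xy: "theta3 0 \<i> = of_real x" "theta4 0 \<i> = of_real y"
    by (metis complex_is_Real_iff Reals_cases)
  have x: "x \<noteq> 0" using theta_null_nonzero xy by auto
  have quart: "theta3 0 \<i> ^ 4 = theta2 0 \<i> ^ 4 + theta4 0 \<i> ^ 4" by (rule expansions)
  have "mod_lambda \<i> = theta2 0 \<i> ^ 4 / theta3 0 \<i> ^ 4"
    by (simp add: mod_lambda_def ell_modulus_def power_divide flip: power_mult)
  also have "theta2 0 \<i> ^ 4 = theta3 0 \<i> ^ 4 - theta4 0 \<i> ^ 4" by (simp add: quart)
  also have "\<dots> / theta3 0 \<i> ^ 4 = of_real (1 - (y / x) ^ 4)"
    unfolding xy using x by (simp add: diff_divide_distrib power_divide)
  finally have "1/3 - 1/6 * mod_lambda \<i> = of_real (1/3 - 1/6 * (1 - (y / x) ^ 4))" by simp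
  moreover have "1/3 - 1/6 * (1 - (y / x) ^ 4) \<noteq> 0"
  proof -
    have "1/3 - 1/6 * (1 - t) \<noteq> 0" if "0 \<le> t" for t :: real using that by simp
    from this[of "(y / x) ^ 4"] show ?thesis using zero_le_even_power[of 4 "y / x"] even_numeral by blast
  qed
  ultimately show "1/3 - 1/6 * mod_lambda \<i> \<noteq> 0" by (simp only: of_real_eq_0_iff not_False_eq_True)
qed

lemma Q_eqI:
  assumes "\<And>\<tau>. \<tau> \<in> upper_half_plane \<Longrightarrow> ell_dedekind_sum \<tau> a b = of_rat r * (1/3 - 1/6 * mod_lambda \<tau>)"
  shows "Q a b = r"
  unfolding Q_def
proof (rule the_equality)
  fix s :: rat
  assume s: "\<forall>\<tau>\<in>upper_half_plane. ell_dedekind_sum \<tau> a b = of_rat s * (1/3 - 1/6 * mod_lambda \<tau>)"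
  obtain \<tau> where \<tau>: "\<tau> \<in> upper_half_plane" "1/3 - 1/6 * mod_lambda \<tau> \<noteq> 0" using exists_nonzero_factor by blast
  have "of_rat s * (1/3 - 1/6 * mod_lambda \<tau>) = of_rat r * (1/3 - 1/6 * mod_lambda \<tau>)"
    using s \<tau>(1) assms by metis
  hence "(of_rat s :: complex) = of_rat r" using mult_right_cancel[OF \<tau>(2)] by blast
  thus "s = r" by simp
qed (use assms in blast)

theorem theorem11:
  fixes a b :: int
  assumes "(a, b) \<in> Uo" and "even a" and "odd b"
  shows "(Q a b \<in> \<int> \<longrightarrow> [a\<^sup>2 = -1] (mod b)) \<and> (Q a b = 0 \<longleftrightarrow> [a\<^sup>2 = -1] (mod b))"
proof -
  have b: "b > 0" "coprime a b" "odd (a + b)" using assms by (auto simp: Uo_def coprime_iff_gcd_eq_1)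
  obtain N where N: "is_numerator a b N" using exists_numerator[OF b] by blast
  have Q: "Q a b = of_int N / of_int (4 * b)"
  proof (rule Q_eqI)
    fix \<tau> assume "\<tau> \<in> upper_half_plane"
    hence "4 * of_int b * ell_dedekind_sum \<tau> a b = of_int N * (1/3 - 1/6 * mod_lambda \<tau>)"
      using N by (simp only: is_numerator_def)
    hence "ell_dedekind_sum \<tau> a b = of_int N / (4 * of_int b) * (1/3 - 1/6 * mod_lambda \<tau>)"
      using b(1) by (simp add: field_simps)
    moreover have "(of_rat (of_int N / of_int (4 * b)) :: complex) = of_int N / (4 * of_int b)"
      by (simp add: of_rat_divide of_rat_mult)
    ultimately show "ell_dedekind_sum \<tau> a b = of_rat (of_int N / of_int (4 * b)) * (1/3 - 1/6 * mod_lambda \<tau>)"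
      by (simp only:)
  qed
  have int: "[a\<^sup>2 = -1] (mod b)" if "Q a b \<in> \<int>"
  proof -
    from that obtain m where "Q a b = of_int m" by (auto elim: Ints_cases)
    hence "(of_int N :: rat) = of_int (4 * b * m)" using Q b(1) by (simp add: field_simps)
    \<comment> \<open>An integral value makes \<open>b\<close> divide \<open>N\<close>, so the
      congruence \<open>a * N = a\<^sup>2 + 1\<close> modulo \<open>b\<close> collapses to the
      claim.\<close>
    hence "N = 4 * b * m" by (simp only: of_int_eq_iff)
    hence "b dvd a * N" by simp
    moreover have "b dvd a * N - (a\<^sup>2 + 1)" using N by (simp add: is_numerator_def cong_iff_dvd_diff)
    ultimately have "b dvd a * N - (a * N - (a\<^sup>2 + 1))" by (rule dvd_diff)
    thus ?thesis by (simp add: cong_iff_dvd_diff)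
  qed
  \<comment> \<open>Here the sum itself vanishes for every \<tau>, which yields
    \<open>Q a b = 0\<close> rather than just integrality; the other direction of the equivalence
    follows because 0 is an integer.\<close>
  moreover have "Q a b = 0" if "[a\<^sup>2 = -1] (mod b)"
  proof (rule Q_eqI)
    fix \<tau> assume "\<tau> \<in> upper_half_plane"
    then interpret upper_half_point \<tau> by (simp add: upper_half_point_iff)
    have "b dvd a\<^sup>2 + 1" using that by (simp add: cong_iff_dvd_diff)
    then obtain m where "a\<^sup>2 + 1 = m * b" by (metis dvdE mult.commute)
    hence "psum a b = 0" by (rule psum_eq_0[OF b(1) assms(3,2)])
    with ell_dedekind_sum_psum[OF b(1), of a] b(1)
    show "ell_dedekind_sum \<tau> a b = of_rat 0 * (1/3 - 1/6 * mod_lambda \<tau>)" by simp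
  qed
  ultimately show ?thesis by (metis Ints_0)
qed

end
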